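(* Let $U$ be a set of $n$ elements, each with an integral value $v(e)$ and a positive integral size $s(e)$, with all densities $\rho(e)=v(e)/s(e)$ distinct, and let $\mathsf{C}$ be a non-decreasing convex cost function. Let $\pi(A)=v(A)-\mathsf{C}(s(A))$ and let $O^*=\operatorname{argmax}_{A\subseteq U}\pi(A)$. Suppose the elements of $U$ arrive in uniformly random order. Then the online algorithm described below, run with constants $k_1=112$ and $\beta=0.262$, outputs a set $O$ with $\mathbb{E}[\pi(O)]\ge \frac{1}{616}\pi(O^* )$, i.e. it is $616$-competitive for the unconstrained problem. The algorithm: with probability $1/2$ it runs the classical secretary (Dynkin) algorithm with respect to the single-element profits $\pi(\{e\})$ and outputs the single chosen element. Otherwise: it draws $k\sim\mathrm{Binomial}(n,1/2)$, lets the sample $X$ be the first $k$ arriving elements and rejects them all; it lets $\tau$ be the largest density of an element of $X$ such that $\pi(P^X_\tau)\ge \beta(1-1/k_1)\,\pi(F^*(X))$; then, starting from $O=\emptyset$, for each subsequent arriving element $i$ it adds $i$ to $O$ if $\pi(O\cup\{i\})-\pi(O)\ge 0$, $\rho(i)\ge\tau$ and $i\notin\mathbb{F}$, and otherwise rejects $i$; it outputs $O$.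
   Context: Sums extend to sets: $v(A)=\sum_{e\in A}v(e)$, $s(A)=\sum_{e\in A}s(e)$. Fractional sets are allowed: $\alpha e$ ($0\le\alpha\le1$) denotes an $\alpha$-fraction of $e$ with value $\alpha v(e)$ and size $\alpha s(e)$; profits of fractional sets are computed with the same formula (the cost function being evaluated at possibly non-integral total sizes, e.g. via its piecewise-linear extension). $\mathbb{F}=\{e\in U:\operatorname{argmax}_{\alpha\in[0,1]}\pi(\alpha e)<1\}$ and $\mathbb{I}=U\setminus\mathbb{F}$. For $T\subseteq U$, $F^*(T)$ denotes a profit-maximizing fractional subset of $T\cap\mathbb{I}$. For a density $\gamma$ and set $T$, $P^T_\gamma=\{e\in T:\rho(e)\ge\gamma\}$. The classical secretary (Dynkin) algorithm rejects the first $\lfloor n/e\rfloor$ elements and then accepts the first element whose profit exceeds that of every element seen so far; it selects the most profitable element with probability about $1/e$. Competitive ratio $c$ means expected profit at least $\pi(O^* )/c$, the expectation being over the random arrival order and the algorithm's coins.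
   Formalization: Assumes C(0)=0; the secretary rule breaks profit ties by a fixed order and never accepts an element of negative profit; the prefix defining τ is taken in X∩𝕀 instead of X; if no τ exists, everything is rejected. The literal claim fails without these changes. *)

theory Defs
  imports "HOL-Probability.Probability" "HOL-Combinatorics.Multiset_Permutations"
begin

text \<open>The cost function is a function on the reals, so that it can be evaluated at fractional total
  sizes; only its values on \<open>{0..}\<close> matter. A cost function given on the natural numbers is covered
  through its piecewise-linear extension.\<close>

definition profit :: "('a \<Rightarrow> int) \<Rightarrow> ('a \<Rightarrow> nat) \<Rightarrow> (real \<Rightarrow> real) \<Rightarrow> 'a set \<Rightarrow> real" where
  "profit v s C A = real_of_int (\<Sum>e\<in>A. v e) - C (real (\<Sum>e\<in>A. s e))"

definition elem_density :: "('a \<Rightarrow> int) \<Rightarrow> ('a \<Rightarrow> nat) \<Rightarrow> 'a \<Rightarrow> real" where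
  "elem_density v s e = real_of_int (v e) / real (s e)"

text \<open>A fractional subset of \<open>T\<close> is represented by its membership function: it contains the
  \<open>x e\<close>-fraction of each element \<open>e\<close>.\<close>

definition fractional_subsets :: "'a set \<Rightarrow> ('a \<Rightarrow> real) set" where
  "fractional_subsets T = {x. (\<forall>e\<in>T. 0 \<le> x e \<and> x e \<le> 1) \<and> (\<forall>e. e \<notin> T \<longrightarrow> x e = 0)}"

definition frac_profit ::
  "('a \<Rightarrow> int) \<Rightarrow> ('a \<Rightarrow> nat) \<Rightarrow> (real \<Rightarrow> real) \<Rightarrow> 'a set \<Rightarrow> ('a \<Rightarrow> real) \<Rightarrow> real" where
  "frac_profit v s C T x = (\<Sum>e\<in>T. x e * real_of_int (v e)) - C (\<Sum>e\<in>T. x e * real (s e))"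

text \<open>The set \<open>\<bbbF>\<close>. If the maximizing fraction of \<open>e\<close> is not unique, \<open>e\<close> belongs to \<open>\<bbbF>\<close> iff
  \<open>\<alpha> = 1\<close> is not among the maximizers.\<close>

definition fractional_elems ::
  "('a \<Rightarrow> int) \<Rightarrow> ('a \<Rightarrow> nat) \<Rightarrow> (real \<Rightarrow> real) \<Rightarrow> 'a set \<Rightarrow> 'a set" where
  "fractional_elems v s C U =
     {e \<in> U. \<forall>\<alpha>. is_arg_max (\<lambda>\<alpha>. frac_profit v s C {e} (\<lambda>_. \<alpha>)) (\<lambda>\<alpha>. \<alpha> \<in> {0..1}) \<alpha> \<longrightarrow> \<alpha> < 1}"

definition integral_elems ::
  "('a \<Rightarrow> int) \<Rightarrow> ('a \<Rightarrow> nat) \<Rightarrow> (real \<Rightarrow> real) \<Rightarrow> 'a set \<Rightarrow> 'a set" where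
  "integral_elems v s C U = U - fractional_elems v s C U"

definition opt_frac ::
  "('a \<Rightarrow> int) \<Rightarrow> ('a \<Rightarrow> nat) \<Rightarrow> (real \<Rightarrow> real) \<Rightarrow> 'a set \<Rightarrow> 'a set \<Rightarrow> 'a \<Rightarrow> real" where
  "opt_frac v s C U T =
     arg_max (frac_profit v s C T) (\<lambda>x. x \<in> fractional_subsets (T \<inter> integral_elems v s C U))"

definition density_prefix :: "('a \<Rightarrow> int) \<Rightarrow> ('a \<Rightarrow> nat) \<Rightarrow> 'a set \<Rightarrow> real \<Rightarrow> 'a set" where
  "density_prefix v s T \<gamma> = {e \<in> T. elem_density v s e \<ge> \<gamma>}"

text \<open>Comparison of single-element profits for the secretary rule. The rule selects the best element
  with probability about \<open>1/e\<close> only if the best element is unique; ties in profit are therefore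
  broken by a fixed order, given by an injective rank function \<open>t\<close>.\<close>

definition exceeds ::
  "('a \<Rightarrow> int) \<Rightarrow> ('a \<Rightarrow> nat) \<Rightarrow> (real \<Rightarrow> real) \<Rightarrow> ('a \<Rightarrow> nat) \<Rightarrow> 'a \<Rightarrow> 'a \<Rightarrow> bool" where
  "exceeds v s C t e e' \<longleftrightarrow>
     profit v s C {e'} < profit v s C {e} \<or>
     profit v s C {e'} = profit v s C {e} \<and> t e' < t e"

text \<open>The list \<open>xs\<close> is the arrival order. Like the threshold rule below, the secretary rule never
  accepts an element whose addition to the (empty) current solution would decrease the profit.\<close>

definition dynkin ::
  "('a \<Rightarrow> int) \<Rightarrow> ('a \<Rightarrow> nat) \<Rightarrow> (real \<Rightarrow> real) \<Rightarrow> ('a \<Rightarrow> nat) \<Rightarrow> 'a list \<Rightarrow> 'a set" where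
  "dynkin v s C t xs =
     (case find (\<lambda>i. nat \<lfloor>real (length xs) / exp 1\<rfloor> \<le> i \<and> 0 \<le> profit v s C {xs ! i} \<and>
                     (\<forall>j<i. exceeds v s C t (xs ! i) (xs ! j)))
                [0..<length xs] of
        None \<Rightarrow> {}
      | Some i \<Rightarrow> {xs ! i})"

text \<open>Candidates for \<open>\<tau>\<close>, given the sample \<open>X\<close>. As the threshold rule works on \<open>\<bbbI>\<close> only, and
  \<open>F\<^sup>*(X)\<close> is a fractional subset of \<open>X \<inter> \<bbbI>\<close>, the density prefix is taken in \<open>X \<inter> \<bbbI>\<close>.\<close>

definition thresholds ::
  "('a \<Rightarrow> int) \<Rightarrow> ('a \<Rightarrow> nat) \<Rightarrow> (real \<Rightarrow> real) \<Rightarrow> real \<Rightarrow> real \<Rightarrow> 'a set \<Rightarrow> 'a set \<Rightarrow> real set" where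
  "thresholds v s C k\<^sub>1 \<beta> U X =
     {\<gamma> \<in> elem_density v s ` X.
        profit v s C (density_prefix v s (X \<inter> integral_elems v s C U) \<gamma>)
          \<ge> \<beta> * (1 - 1 / k\<^sub>1) * frac_profit v s C X (opt_frac v s C U X)}"

definition online_step ::
  "('a \<Rightarrow> int) \<Rightarrow> ('a \<Rightarrow> nat) \<Rightarrow> (real \<Rightarrow> real) \<Rightarrow> 'a set \<Rightarrow> real \<Rightarrow> 'a \<Rightarrow> 'a set \<Rightarrow> 'a set" where
  "online_step v s C U \<tau> i S =
     (if profit v s C (S \<union> {i}) - profit v s C S \<ge> 0 \<and> elem_density v s i \<ge> \<tau>
         \<and> i \<notin> fractional_elems v s C U
      then S \<union> {i} else S)"

text \<open>If the sample admits no threshold, everything is rejected.\<close>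

definition threshold_rule ::
  "('a \<Rightarrow> int) \<Rightarrow> ('a \<Rightarrow> nat) \<Rightarrow> (real \<Rightarrow> real) \<Rightarrow> real \<Rightarrow> real \<Rightarrow> 'a set \<Rightarrow> 'a list \<Rightarrow> nat \<Rightarrow> 'a set" where
  "threshold_rule v s C k\<^sub>1 \<beta> U xs k =
     (let \<Theta> = thresholds v s C k\<^sub>1 \<beta> U (set (take k xs))
      in if \<Theta> = {} then {} else fold (online_step v s C U (Max \<Theta>)) (drop k xs) {})"

definition online_alg ::
  "('a \<Rightarrow> int) \<Rightarrow> ('a \<Rightarrow> nat) \<Rightarrow> (real \<Rightarrow> real) \<Rightarrow> ('a \<Rightarrow> nat) \<Rightarrow> real \<Rightarrow> real \<Rightarrow> 'a set
     \<Rightarrow> 'a list \<Rightarrow> 'a set pmf" where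
  "online_alg v s C t k\<^sub>1 \<beta> U xs =
     bind_pmf (bernoulli_pmf (1/2)) (\<lambda>b.
       if b then return_pmf (dynkin v s C t xs)
       else map_pmf (threshold_rule v s C k\<^sub>1 \<beta> U xs) (binomial_pmf (card U) (1/2)))"

definition online_output ::
  "('a \<Rightarrow> int) \<Rightarrow> ('a \<Rightarrow> nat) \<Rightarrow> (real \<Rightarrow> real) \<Rightarrow> ('a \<Rightarrow> nat) \<Rightarrow> real \<Rightarrow> real \<Rightarrow> 'a set \<Rightarrow> 'a set pmf" where
  "online_output v s C t k\<^sub>1 \<beta> U =
     bind_pmf (pmf_of_set (permutations_of_set U)) (online_alg v s C t k\<^sub>1 \<beta> U)"

end

theory Submission
  imports Defs
begin

text \<open>
  Let \<open>F\<close> be the profit of the fractional optimum on the integral elements and \<open>M \<ge> 0\<close> a bound on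
  the profit of every single element, attained unless it is \<open>0\<close>. An optimal set contains at most
  one element of \<open>\<bbbF>\<close>, since the smaller of two such elements would have negative marginal profit;
  hence its profit is at most \<open>F + M\<close>.

  If \<open>F \<le> 20 M\<close>, the secretary rule suffices: it finds the best element whenever the second best
  lies in the rejected part and the best does not, which has probability at least \<open>1/12\<close> if
  \<open>n \<ge> 3\<close>; for smaller \<open>n\<close> nothing is rejected beforehand.

  If \<open>F > 20 M\<close>, a density prefix \<open>Q\<close> of the integral elements has profit at least \<open>F - M\<close> and
  non-negative marginal profits. The marginal profits along the density order are weights, each at
  most \<open>M\<close>, that add up to the profit on density prefixes of \<open>Q\<close> and bound it from below on every
  subset of \<open>Q\<close>. With \<open>B = \<beta> (1 - 1/k\<^sub>1)\<close>, suppose that the sample contains weight at least \<open>B F\<close>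
  of \<open>Q\<close>. Then the elements above the threshold form a prefix inside \<open>Q\<close> of weight at least
  \<open>B\<^sup>2 F\<close>, all later ones are accepted, and they include the later part of the smallest prefix \<open>R\<close> of
  weight at least \<open>B\<^sup>2 F\<close>. As \<open>R\<close> is fixed in advance, half of its weight arrives late on average,
  and Chebyshev's inequality bounds the loss from the samples that contain too little of \<open>Q\<close>. The
  constants leave enough slack for the case distinction at \<open>20\<close> instead of \<open>k\<^sub>1 = 112\<close>, which is why
  a crude bound for the secretary rule is enough.
\<close>

section \<open>Convex functions on the half-line\<close>

text \<open>Both \<open>x + h\<close> and \<open>y\<close> are convex combinations of
  \<open>x\<close> and \<open>y + h\<close>, with complementary weights; adding the two convexity
  inequalities gives the claim.\<close>

lemma convex_on_increment_mono:
  fixes C :: "real \<Rightarrow> real"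
  assumes "convex_on {0..} C" and "0 \<le> x" "x \<le> y" "0 \<le> h"
  shows "C (x + h) - C x \<le> C (y + h) - C y"
proof (cases "y + h - x = 0")
  case True
  then have "h = 0" "x = y" using assms by linarith+
  then show ?thesis by simp
next
  case False
  define L where "L = y + h - x"
  define u where "u = h / L"
  have L: "L > 0" using False assms unfolding L_def by linarith
  have u: "0 \<le> u" "u \<le> 1" "u * L = h"
    using L assms by (auto simp: u_def L_def)
  have "C ((1 - u) *\<^sub>R x + u *\<^sub>R (y + h)) \<le> (1 - u) * C x + u * C (y + h)"
    using assms u by (intro convex_onD[of "{0..}"]) auto
  moreover have "C ((1 - (1 - u)) *\<^sub>R x + (1 - u) *\<^sub>R (y + h)) \<le> (1 - (1 - u)) * C x + (1 - u) * C (y + h)"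
    using assms u by (intro convex_onD[of "{0..}"]) auto
  moreover have "(1 - u) *\<^sub>R x + u *\<^sub>R (y + h) = x + h"
    "(1 - (1 - u)) *\<^sub>R x + (1 - u) *\<^sub>R (y + h) = y"
    using u(3) unfolding L_def by (simp_all add: algebra_simps)
  ultimately show ?thesis by (simp add: algebra_simps)
qed

text \<open>Convexity alone gives continuity only on the open half-line. At 0, monotonicity bounds
  \<open>C\<close> from below and the chord over the unit interval bounds it from above. Continuity
  is what makes fractional optima exist.\<close>

lemma convex_mono_on_continuous:
  fixes C :: "real \<Rightarrow> real"
  assumes "convex_on {0..} C" and "mono_on {0..} C"
  shows "continuous_on {0..} C"
proof -
  have "continuous_on {0<..} C"
    using assms(1) by (intro convex_on_continuous) (auto intro: convex_on_subset)
  then have pos: "isCont C x" if "x > 0" for x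
    using that by (simp add: continuous_on_eq_continuous_at)
  have "(C \<longlongrightarrow> C 0) (at 0 within {0..})"
  proof (rule tendsto_sandwich)
    have "eventually (\<lambda>x::real. x < 1) (at 0 within {0..})"
      by (rule order_tendstoD[of "\<lambda>x. x" 0]) auto
    moreover have ev: "eventually (\<lambda>x. x \<in> {0..}) (at (0::real) within {0..})"
      by (simp add: eventually_at_filter)
    ultimately show "eventually (\<lambda>x. C x \<le> (1 - x) * C 0 + x * C 1) (at 0 within {0..})"
    proof eventually_elim
      case (elim x)
      then show ?case using convex_onD[OF assms(1), of x 0 1] by simp
    qed
    show "eventually (\<lambda>x. C 0 \<le> C x) (at 0 within {0..})"
      using ev by eventually_elim (auto intro: mono_onD[OF assms(2)])
    have "((\<lambda>x. (1 - x) * C 0 + x * C 1) \<longlongrightarrow> (1 - 0) * C 0 + 0 * C 1) (at 0 within {0..})"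
      by (intro tendsto_intros)
    then show "((\<lambda>x. (1 - x) * C 0 + x * C 1) \<longlongrightarrow> C 0) (at 0 within {0..})"
      by simp
  qed auto
  then show ?thesis
    unfolding continuous_on_eq_continuous_within
    by (metis (full_types) atLeast_iff continuous_at_imp_continuous_at_within continuous_within
        less_eq_real_def pos)
qed

section \<open>Prefixes of uniformly random permutations\<close>

lemma sum_permutations_of_set_map:
  assumes "\<sigma> permutes A"
  shows "(\<Sum>xs\<in>permutations_of_set A. g (map \<sigma> xs)) = (\<Sum>xs\<in>permutations_of_set A. g xs)"
proof -
  have "inj (map \<sigma>)" using assms by (simp add: permutes_inj)
  then have "inj_on (map \<sigma>) (permutations_of_set A)" by (rule inj_on_subset) simp
  then show ?thesis
    using sum.reindex[of "map \<sigma>" "permutations_of_set A" g]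
    by (simp add: permutations_of_set_image_permutes[OF assms])
qed

text \<open>A real-valued indicator, so that moments of sampled weights follow by linearity.\<close>

definition in_prefix :: "nat \<Rightarrow> 'a list \<Rightarrow> 'a \<Rightarrow> real" where
  "in_prefix k xs e = (if e \<in> set (take k xs) then 1 else 0)"

lemma in_prefix_map:
  assumes "\<sigma> permutes A"
  shows "in_prefix k (map \<sigma> xs) (\<sigma> e) = in_prefix k xs e"
  using permutes_inj[OF assms] unfolding in_prefix_def
  by (simp add: take_map inj_image_mem_iff)

lemma sum_in_prefix:
  assumes "xs \<in> permutations_of_set A" and "k \<le> card A"
  shows "(\<Sum>e\<in>A. in_prefix k xs e) = real k"
proof -
  have A: "set xs = A" "distinct xs" "length xs = card A"
    using assms permutations_of_setD length_finite_permutations_of_set by metis+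
  have "(\<Sum>e\<in>A. in_prefix k xs e) = real (card (A \<inter> set (take k xs)))"
    unfolding in_prefix_def using A(1) by (subst sum.If_cases) (auto simp flip: Int_def)
  also have "A \<inter> set (take k xs) = set (take k xs)"
    using A(1) by (auto dest: in_set_takeD)
  also have "card (set (take k xs)) = k"
    using A assms(2) by (simp add: distinct_card)
  finally show ?thesis .
qed

text \<open>Transposing two elements shows that each lies in the prefix for equally many orders, and
  every order puts exactly \<open>k\<close> elements there.\<close>

lemma sum_permutations_in_prefix:
  assumes "finite A" and "k \<le> card A" and "e \<in> A"
  shows "(\<Sum>xs\<in>permutations_of_set A. in_prefix k xs e) * card A = real k * fact (card A)"
proof -
  let ?N = "\<lambda>e. \<Sum>xs\<in>permutations_of_set A. in_prefix k xs e"
  have "?N f = ?N e" if f: "f \<in> A" for f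
  proof -
    have p: "Transposition.transpose e f permutes A" using f assms by (simp add: permutes_swap_id)
    have "?N f = (\<Sum>xs\<in>permutations_of_set A. in_prefix k (map (Transposition.transpose e f) xs) f)"
      by (rule sum_permutations_of_set_map[OF p, symmetric])
    also have "\<dots> = ?N e"
      using in_prefix_map[OF p, of k _ e] by simp
    finally show ?thesis .
  qed
  then have "?N e * card A = (\<Sum>f\<in>A. ?N f)" by simp
  also have "\<dots> = (\<Sum>xs\<in>permutations_of_set A. \<Sum>f\<in>A. in_prefix k xs f)"
    by (rule sum.swap)
  also have "\<dots> = real k * fact (card A)"
    using assms by (simp add: sum_in_prefix)
  finally show ?thesis .
qed

text \<open>The same double counting with \<open>e\<close> held fixed: transposing \<open>f\<close>
  with another element shows that all partners of \<open>e\<close> share the prefix with it equally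
  often.\<close>

lemma sum_permutations_in_prefix_pair:
  assumes "finite A" and "k \<le> card A" and "e \<in> A" "f \<in> A" "e \<noteq> f"
  shows "(\<Sum>xs\<in>permutations_of_set A. in_prefix k xs e * in_prefix k xs f)
           * (real (card A) * (real (card A) - 1)) = real k * (real k - 1) * fact (card A)"
proof -
  let ?N = "\<lambda>e f. \<Sum>xs\<in>permutations_of_set A. in_prefix k xs e * in_prefix k xs f"
  have sq: "in_prefix k xs e * in_prefix k xs e = in_prefix k xs e" for xs and e :: 'a
    by (simp add: in_prefix_def)
  have sw: "?N e h = ?N e f" if "e \<in> A" "h \<in> A" "f \<in> A" "h \<noteq> e" "f \<noteq> e" for e f h
  proof -
    have p: "Transposition.transpose f h permutes A" using that by (simp add: permutes_swap_id)
    have "Transposition.transpose f h e = e" using that by (simp add: Transposition.transpose_def)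
    then have "in_prefix k (map (Transposition.transpose f h) xs) e = in_prefix k xs e" for xs
      using in_prefix_map[OF p, of k xs e] by simp
    moreover have "in_prefix k (map (Transposition.transpose f h) xs) h = in_prefix k xs f" for xs
      using in_prefix_map[OF p, of k xs f] by simp
    ultimately show ?thesis
      using sum_permutations_of_set_map[OF p, of "\<lambda>xs. in_prefix k xs e * in_prefix k xs h"]
      by simp
  qed
  have c1: "card A \<ge> 1" using assms by (metis One_nat_def Suc_leI card_gt_0_iff empty_iff)
  have "(\<Sum>h\<in>A-{e}. ?N e h) = (\<Sum>h\<in>A-{e}. ?N e f)"
    using assms by (intro sum.cong refl sw) auto
  then have "?N e f * (real (card A) - 1) = (\<Sum>h\<in>A-{e}. ?N e h)"
    using assms c1 by (simp add: of_nat_diff)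
  also have "\<dots> = (\<Sum>xs\<in>permutations_of_set A. in_prefix k xs e * (\<Sum>h\<in>A-{e}. in_prefix k xs h))"
    by (subst sum.swap) (simp add: sum_distrib_left)
  \<comment> \<open>If \<open>e\<close> is in the prefix, then so are \<open>k - 1\<close> other
    elements; otherwise both sides vanish.\<close>
  also have "\<dots> = (\<Sum>xs\<in>permutations_of_set A. (real k - 1) * in_prefix k xs e)"
  proof (rule sum.cong)
    fix xs assume "xs \<in> permutations_of_set A"
    then have "(\<Sum>h\<in>A-{e}. in_prefix k xs h) = real k - in_prefix k xs e"
      using assms sum_in_prefix[of xs A k] by (simp add: sum_diff1)
    then show "in_prefix k xs e * (\<Sum>h\<in>A-{e}. in_prefix k xs h) = (real k - 1) * in_prefix k xs e"
      using sq[of xs e] by (simp only: right_diff_distrib left_diff_distrib) simp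
  qed simp
  also have "\<dots> = (real k - 1) * (\<Sum>xs\<in>permutations_of_set A. in_prefix k xs e)"
    by (simp add: sum_distrib_left)
  finally have "?N e f * (real (card A) - 1) * real (card A)
      = (real k - 1) * ((\<Sum>xs\<in>permutations_of_set A. in_prefix k xs e) * real (card A))"
    by simp
  then show ?thesis
    unfolding sum_permutations_in_prefix[OF assms(1-3)] by (simp only: mult_ac)
qed

text \<open>The expectation for a prefix length drawn from Binomial(\<open>card A\<close>, 1/2) and
  an independent uniform order, as a finite sum.\<close>

definition sample_mean :: "'a set \<Rightarrow> (nat \<Rightarrow> 'a list \<Rightarrow> real) \<Rightarrow> real" where
  "sample_mean A g = (\<Sum>k\<le>card A. real (card A choose k) / 2 ^ card A *
      ((\<Sum>xs\<in>permutations_of_set A. g k xs) / fact (card A)))"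

section \<open>Linearity of the sampling average and moments of the prefix indicators\<close>

lemma sample_mean_mono:
  assumes "\<And>k xs. k \<le> card A \<Longrightarrow> xs \<in> permutations_of_set A \<Longrightarrow> g k xs \<le> h k xs"
  shows "sample_mean A g \<le> sample_mean A h"
  unfolding sample_mean_def using assms
  by (intro sum_mono mult_left_mono divide_right_mono) auto

lemma sample_mean_add: "sample_mean A (\<lambda>k xs. g k xs + h k xs) = sample_mean A g + sample_mean A h"
  by (simp add: sample_mean_def sum.distrib add_divide_distrib distrib_left)

lemma sample_mean_cmult: "sample_mean A (\<lambda>k xs. c * g k xs) = c * sample_mean A g"
  by (simp add: sample_mean_def sum_distrib_left mult.left_commute sum_divide_distrib)

lemma sample_mean_sum:
  "sample_mean A (\<lambda>k xs. \<Sum>i\<in>I. g i k xs) = (\<Sum>i\<in>I. sample_mean A (g i))"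
proof (cases "finite I")
  case True
  then show ?thesis
    by (induction I rule: finite_induct) (simp_all add: sample_mean_add, simp add: sample_mean_def)
qed (simp add: sample_mean_def)

lemma sample_mean_const:
  assumes "finite A"
  shows "sample_mean A (\<lambda>_ _. c) = c"
proof -
  have "(\<Sum>k\<le>n. real (n choose k)) = 2 ^ n" for n
    using choose_row_sum[of n] by (metis of_nat_numeral of_nat_power of_nat_sum)
  then show ?thesis
    using assms by (simp add: sample_mean_def flip: sum_divide_distrib sum_distrib_right)
qed

lemma sample_mean_in_prefix:
  assumes "finite A" and "e \<in> A"
  shows "sample_mean A (\<lambda>k xs. in_prefix k xs e) = 1 / 2"
proof -
  define n where "n = card A"
  have n: "n > 0" using assms by (auto simp: n_def card_gt_0_iff)
  have "sample_mean A (\<lambda>k xs. in_prefix k xs e) = (\<Sum>k\<le>n. real (n choose k) / 2 ^ n * (real k / n))"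
    unfolding sample_mean_def n_def[symmetric]
  proof (intro sum.cong refl arg_cong2[of _ _ _ _ "(*)"])
    fix k assume "k \<in> {..n}"
    then show "(\<Sum>xs\<in>permutations_of_set A. in_prefix k xs e) / fact n = real k / n"
      using sum_permutations_in_prefix[OF assms(1) _ assms(2), of k] n
      by (simp add: n_def field_simps)
  qed
  also have "\<dots> = real (\<Sum>k\<le>n. k * (n choose k)) / (n * 2 ^ n)"
    by (simp add: sum_divide_distrib mult_ac)
  also have "\<dots> = 1 / 2"
  proof -
    have "(2::real) ^ n = 2 * 2 ^ (n - 1)" using n by (cases n) auto
    then show ?thesis unfolding choose_linear_sum using n by simp
  qed
  finally show ?thesis .
qed

text \<open>The second factorial moment of the binomial distribution: absorbing one factor into the
  binomial coefficient reduces it to the first moment.\<close>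

lemma choose_falling_factorial_sum:
  "(\<Sum>k\<le>n. k * (k - 1) * (n choose k)) = n * (n - 1) * 2 ^ (n - 2)"
proof (cases n)
  case (Suc m)
  have "(\<Sum>k\<le>Suc m. k * (k - 1) * (Suc m choose k)) = (\<Sum>k\<le>m. k * (Suc k * (Suc m choose Suc k)))"
    by (subst sum.atMost_Suc_shift) (simp del: binomial_Suc_Suc add: algebra_simps)
  also have "\<dots> = Suc m * (\<Sum>k\<le>m. k * (m choose k))"
    unfolding Suc_times_binomial by (simp only: sum_distrib_left mult_ac)
  finally show ?thesis
    unfolding choose_linear_sum using Suc by (simp add: numeral_2_eq_2 algebra_simps)
qed simp

text \<open>The value is the product of the two means, so memberships in the sample are
  uncorrelated. This is the effect of a binomial prefix length.\<close>

lemma sample_mean_in_prefix_pair: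
  assumes "finite A" and "e \<in> A" "f \<in> A" "e \<noteq> f"
  shows "sample_mean A (\<lambda>k xs. in_prefix k xs e * in_prefix k xs f) = 1 / 4"
proof -
  define n where "n = card A"
  have "card {e, f} \<le> n" unfolding n_def using assms by (intro card_mono) auto
  then have n: "n \<ge> 2" using assms by simp
  have "sample_mean A (\<lambda>k xs. in_prefix k xs e * in_prefix k xs f)
      = (\<Sum>k\<le>n. real (n choose k) / 2 ^ n * (real k * (real k - 1) / (n * (real n - 1))))"
    unfolding sample_mean_def n_def[symmetric]
  proof (intro sum.cong refl arg_cong2[of _ _ _ _ "(*)"])
    fix k assume "k \<in> {..n}"
    then show "(\<Sum>xs\<in>permutations_of_set A. in_prefix k xs e * in_prefix k xs f) / fact n
        = real k * (real k - 1) / (n * (real n - 1))"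
      using sum_permutations_in_prefix_pair[OF assms(1) _ assms(2-4), of k] n
      by (simp add: n_def frac_eq_eq)
  qed
  also have "\<dots> = real (\<Sum>k\<le>n. k * (k - 1) * (n choose k)) / (n * (real n - 1) * 2 ^ n)"
    unfolding of_nat_sum sum_divide_distrib
  proof (intro sum.cong refl)
    fix k
    have "real k * (real k - 1) = real (k * (k - 1))"
      by (cases k) (simp_all add: algebra_simps)
    then show "real (n choose k) / 2 ^ n * (real k * (real k - 1) / (n * (real n - 1)))
        = real (k * (k - 1) * (n choose k)) / (n * (real n - 1) * 2 ^ n)"
      by (simp only: of_nat_mult times_divide_times_eq mult_ac)
  qed
  also have "\<dots> = 1 / 4"
  proof -
    have "(2::real) ^ n = 4 * 2 ^ (n - 2)"
      using n by (subst le_add_diff_inverse[OF n, symmetric], subst power_add) simp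
    moreover have "real (n - 1) = real n - 1" using n by simp
    ultimately show ?thesis
      unfolding choose_falling_factorial_sum of_nat_mult using n by simp
  qed
  finally show ?thesis .
qed

section \<open>Mean and variance of the sampled weight\<close>

definition prefix_weight :: "('a \<Rightarrow> real) \<Rightarrow> 'a set \<Rightarrow> nat \<Rightarrow> 'a list \<Rightarrow> real" where
  "prefix_weight a Q k xs = (\<Sum>e\<in>Q. a e * in_prefix k xs e)"

lemma prefix_weight_eq:
  "finite Q \<Longrightarrow> prefix_weight a Q k xs = sum a (Q \<inter> set (take k xs))"
  unfolding prefix_weight_def in_prefix_def
  by (simp add: if_distrib[of "(*) _"] sum.If_cases cong: if_cong)

lemma sample_mean_prefix_weight:
  assumes "finite A" and "Q \<subseteq> A"
  shows "sample_mean A (prefix_weight a Q) = sum a Q / 2"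
proof -
  have "sample_mean A (prefix_weight a Q)
      = (\<Sum>e\<in>Q. a e * sample_mean A (\<lambda>k xs. in_prefix k xs e))"
    unfolding prefix_weight_def by (simp add: sample_mean_sum sample_mean_cmult)
  also have "\<dots> = (\<Sum>e\<in>Q. a e * (1 / 2))"
    using assms by (intro sum.cong refl) (auto simp: sample_mean_in_prefix)
  finally show ?thesis by (simp add: sum_divide_distrib)
qed

text \<open>In the expanded square only the diagonal survives, because the centred indicators are
  uncorrelated and have variance 1/4.\<close>

lemma sample_variance_prefix_weight:
  assumes "finite A" and "Q \<subseteq> A"
  shows "sample_mean A (\<lambda>k xs. (prefix_weight a Q k xs - sum a Q / 2)\<^sup>2) = (\<Sum>e\<in>Q. (a e)\<^sup>2) / 4"
proof -
  have finQ: "finite Q" using assms finite_subset by blast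
  let ?z = "\<lambda>e k xs. in_prefix k xs e - 1 / 2"
  have cov: "sample_mean A (\<lambda>k xs. ?z e k xs * ?z f k xs) = (if e = f then 1 / 4 else 0)"
    if "e \<in> A" "f \<in> A" for e f
  proof -
    have "(\<lambda>k xs. ?z e k xs * ?z f k xs) = (\<lambda>k xs. in_prefix k xs e * in_prefix k xs f
         + ((- (1 / 2)) * in_prefix k xs e + ((- (1 / 2)) * in_prefix k xs f + 1 / 4)))"
      by (intro ext) (simp add: algebra_simps)
    then have "sample_mean A (\<lambda>k xs. ?z e k xs * ?z f k xs)
        = sample_mean A (\<lambda>k xs. in_prefix k xs e * in_prefix k xs f)
          + (- (1 / 2) * (1 / 2) + (- (1 / 2) * (1 / 2) + 1 / 4))"
      using that assms(1)
      by (simp only: sample_mean_add sample_mean_cmult sample_mean_const sample_mean_in_prefix)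
    then have eq: "sample_mean A (\<lambda>k xs. ?z e k xs * ?z f k xs)
        = sample_mean A (\<lambda>k xs. in_prefix k xs e * in_prefix k xs f) - 1 / 4"
      by simp
    show ?thesis
    proof (cases "e = f")
      case True
      have "(\<lambda>k xs. in_prefix k xs e * in_prefix k xs e) = (\<lambda>k xs. in_prefix k xs e)"
        by (intro ext) (simp add: in_prefix_def)
      then show ?thesis
        using eq True that assms(1) by (simp add: sample_mean_in_prefix)
    next
      case False
      then show ?thesis
        using eq that assms(1) by (simp add: sample_mean_in_prefix_pair)
    qed
  qed
  have "prefix_weight a Q k xs - sum a Q / 2 = (\<Sum>e\<in>Q. a e * ?z e k xs)" for k xs
    unfolding prefix_weight_def
    by (simp add: right_diff_distrib sum_subtractf sum_divide_distrib)
  then have "(prefix_weight a Q k xs - sum a Q / 2)\<^sup>2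
      = (\<Sum>e\<in>Q. \<Sum>f\<in>Q. (a e * a f) * (?z e k xs * ?z f k xs))" for k xs
    by (simp add: power2_eq_square sum_product mult_ac)
  then have "sample_mean A (\<lambda>k xs. (prefix_weight a Q k xs - sum a Q / 2)\<^sup>2)
      = (\<Sum>e\<in>Q. \<Sum>f\<in>Q. (a e * a f) * sample_mean A (\<lambda>k xs. ?z e k xs * ?z f k xs))"
    by (simp only: sample_mean_sum sample_mean_cmult)
  also have "\<dots> = (\<Sum>e\<in>Q. \<Sum>f\<in>Q. (a e * a f) * (if e = f then 1 / 4 else 0))"
    using assms(2) by (intro sum.cong refl) (auto simp: cov subset_iff)
  also have "\<dots> = (\<Sum>e\<in>Q. (a e)\<^sup>2) / 4"
    using finQ by (simp add: sum_divide_distrib power2_eq_square if_distrib[of "(*) _"] cong: if_cong)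
  finally show ?thesis .
qed

section \<open>Profits\<close>

locale convex_cost =
  fixes U :: "'a set" and v :: "'a \<Rightarrow> int" and s :: "'a \<Rightarrow> nat" and C :: "real \<Rightarrow> real"
  assumes finite_U: "finite U"
    and size_pos: "\<And>e. e \<in> U \<Longrightarrow> s e > 0"
    and inj_density: "inj_on (elem_density v s) U"
    and mono_C: "mono_on {0..} C" and convex_C: "convex_on {0..} C" and C_0: "C 0 = 0"
begin

abbreviation pr :: "'a set \<Rightarrow> real" where "pr \<equiv> profit v s C"
abbreviation dens :: "'a \<Rightarrow> real" where "dens \<equiv> elem_density v s"
abbreviation Int_elems :: "'a set" where "Int_elems \<equiv> integral_elems v s C U"
abbreviation frac_opt :: "'a set \<Rightarrow> real" where
  "frac_opt X \<equiv> frac_profit v s C X (opt_frac v s C U X)"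

lemma profit_empty: "pr {} = 0"
  by (simp add: profit_def C_0)

lemma profit_insert:
  "finite A \<Longrightarrow> e \<notin> A \<Longrightarrow>
    pr (insert e A) = pr A + v e - (C (real (sum s A) + real (s e)) - C (real (sum s A)))"
  by (simp add: profit_def add.commute)

text \<open>Diminishing returns: the value gained is the same, while convexity makes the same extra
  size cost more on top of a larger set.\<close>

lemma profit_marginal_antimono:
  assumes "finite B" and "A \<subseteq> B" and "e \<notin> B"
  shows "pr (insert e B) - pr B \<le> pr (insert e A) - pr A"
proof -
  have A: "finite A" "e \<notin> A" using assms finite_subset by auto
  have "sum s A \<le> sum s B" using assms by (intro sum_mono2) auto
  then have "C (real (sum s A) + real (s e)) - C (real (sum s A))
      \<le> C (real (sum s B) + real (s e)) - C (real (sum s B))"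
    by (intro convex_on_increment_mono[OF convex_C]) (simp_all del: of_nat_sum)
  then show ?thesis
    unfolding profit_insert[OF A] profit_insert[OF assms(1,3)] by simp
qed

lemma profit_insert_le:
  "finite A \<Longrightarrow> e \<notin> A \<Longrightarrow> pr (insert e A) \<le> pr A + pr {e}"
  using profit_marginal_antimono[of A "{}" e] by (simp add: profit_empty)

lemma density_eq_iff: "e \<in> U \<Longrightarrow> f \<in> U \<Longrightarrow> dens e = dens f \<longleftrightarrow> e = f"
  using inj_density by (auto dest: inj_onD)

lemma Int_elems_subset: "Int_elems \<subseteq> U"
  by (auto simp: integral_elems_def)

text \<open>Outside \<bbbF>, the negated definition supplies a maximizing fraction that is not below
  1, so the whole element is a maximizer.\<close>

lemma Int_elems_fraction_le:
  fixes \<alpha> :: real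
  assumes "e \<in> Int_elems" and "0 \<le> \<alpha>" "\<alpha> \<le> 1"
  shows "\<alpha> * v e - C (\<alpha> * s e) \<le> pr {e}"
proof -
  obtain a where a: "is_arg_max (\<lambda>\<alpha>. frac_profit v s C {e} (\<lambda>_. \<alpha>)) (\<lambda>\<alpha>. \<alpha> \<in> {0..1}) a" "\<not> a < 1"
    using assms(1) unfolding integral_elems_def fractional_elems_def by auto
  then have "a = 1" by (auto simp: is_arg_max_def)
  with a(1) assms(2,3) have "frac_profit v s C {e} (\<lambda>_. \<alpha>) \<le> frac_profit v s C {e} (\<lambda>_. 1)"
    unfolding is_arg_max_def by (metis atLeastAtMost_iff not_le_imp_less)
  then show ?thesis by (simp add: frac_profit_def profit_def)
qed

text \<open>Some fraction of \<open>e\<close> beats all of it, so completing \<open>e\<close> costs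
  more than it gains; beyond size \<open>s e\<close> the slope of \<open>C\<close> is at least as
  large. Hence \<bbbF>-elements lose profit on top of anything of at least their size.\<close>

lemma fractional_elems_marginal:
  fixes y :: real
  assumes "e \<in> fractional_elems v s C U" and "real (s e) \<le> y"
  shows "v e < C (y + s e) - C y"
proof -
  let ?f = "\<lambda>\<alpha>. frac_profit v s C {e} (\<lambda>_. \<alpha>)"
  have "\<not> is_arg_max ?f (\<lambda>\<alpha>. \<alpha> \<in> {0..1}) 1"
    using assms(1) unfolding fractional_elems_def by force
  then obtain \<alpha> where \<alpha>: "0 \<le> \<alpha>" "\<alpha> \<le> 1" "?f \<alpha> > ?f 1"
    unfolding is_arg_max_def by auto
  then have \<alpha>1: "\<alpha> < 1" by (cases "\<alpha> = 1") auto
  have "(1 - \<alpha>) * v e < C (s e) - C (\<alpha> * s e)"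
    using \<alpha>(3) by (simp add: frac_profit_def algebra_simps)
  also have "C (s e) - C (\<alpha> * s e) \<le> (1 - \<alpha>) * (C (real (s e) + s e) - C (s e))"
  proof -
    \<comment> \<open>The point \<open>s e\<close> divides the segment from
      \<open>\<alpha> * s e\<close> to \<open>2 * s e\<close> with weight \<open>u\<close> on the
      far end. Clearing the denominator \<open>2 - \<alpha>\<close> compares the slopes of
      \<open>C\<close> on both sides of \<open>s e\<close>.\<close>
    define u where "u = (1 - \<alpha>) / (2 - \<alpha>)"
    have u: "0 \<le> u" "u \<le> 1" "u * (2 - \<alpha>) = 1 - \<alpha>" "(1 - u) * (2 - \<alpha>) = 1"
      using \<alpha> \<alpha>1 by (auto simp: u_def field_simps)
    have "C ((1 - u) *\<^sub>R (\<alpha> * s e) + u *\<^sub>R (real (s e) + s e))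
        \<le> (1 - u) * C (\<alpha> * s e) + u * C (real (s e) + s e)"
      using \<alpha> u by (intro convex_onD[OF convex_C]) auto
    moreover have "(1 - u) *\<^sub>R (\<alpha> * s e) + u *\<^sub>R (real (s e) + s e) = s e"
    proof -
      have "(1 - u) * \<alpha> + 2 * u = 1" using u(3) by (simp add: algebra_simps)
      then have "((1 - u) * \<alpha> + 2 * u) * real (s e) = real (s e)" by simp
      then show ?thesis by (simp add: algebra_simps)
    qed
    ultimately have "C (s e) \<le> (1 - u) * C (\<alpha> * s e) + u * C (real (s e) + s e)" by simp
    then have "(2 - \<alpha>) * C (s e) \<le> (2 - \<alpha>) * ((1 - u) * C (\<alpha> * s e) + u * C (real (s e) + s e))"
      using \<alpha>1 by (intro mult_left_mono) auto
    also have "\<dots> = ((1 - u) * (2 - \<alpha>)) * C (\<alpha> * s e) + (u * (2 - \<alpha>)) * C (real (s e) + s e)"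
      by (simp add: algebra_simps)
    finally show ?thesis unfolding u by (simp add: algebra_simps)
  qed
  also have "\<dots> \<le> (1 - \<alpha>) * (C (y + s e) - C y)"
    using assms(2) \<alpha>1 by (intro mult_left_mono convex_on_increment_mono[OF convex_C]) auto
  finally show ?thesis using \<alpha>1 by simp
qed

section \<open>Fractional optima\<close>

text \<open>A product of unit intervals and singletons, hence compact by Tychonoff's
  theorem.\<close>

lemma compact_fractional_subsets: "compact (fractional_subsets T)"
proof -
  have "fractional_subsets T = (\<Pi>\<^sub>E e\<in>UNIV. if e \<in> T then {0..1} else {0})"
    by (auto simp: fractional_subsets_def PiE_iff split: if_splits)
  moreover have "compactin (product_topology (\<lambda>_. euclidean) UNIV)
      (\<Pi>\<^sub>E e\<in>UNIV. if e \<in> T then {0..1::real} else {0})"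
    by (subst compactin_PiE) auto
  ultimately show ?thesis by (simp add: euclidean_product_topology)
qed

lemma frac_profit_attains_max:
  assumes "X \<subseteq> U"
  shows "\<exists>x\<in>fractional_subsets (X \<inter> Int_elems).
           \<forall>y\<in>fractional_subsets (X \<inter> Int_elems). frac_profit v s C X y \<le> frac_profit v s C X x"
proof (rule continuous_attains_sup[OF compact_fractional_subsets])
  let ?S = "fractional_subsets (X \<inter> Int_elems)"
  have "(\<lambda>_. 0) \<in> ?S" by (simp add: fractional_subsets_def)
  then show "?S \<noteq> {}" by blast
  \<comment> \<open>Total sizes must stay in \<open>{0..}\<close>, where \<open>C\<close> is known
    to be continuous.\<close>
  have nonneg: "0 \<le> x e" if "x \<in> ?S" for x e
    using that unfolding fractional_subsets_def by (cases "e \<in> X \<inter> Int_elems") auto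
  have coord: "continuous_on ?S (\<lambda>x. x e)" for e
    by (rule continuous_on_subset[OF continuous_on_product_coordinates]) simp
  have "continuous_on ?S (\<lambda>x. C (\<Sum>e\<in>X. x e * real (s e)))"
  proof (rule continuous_on_compose2[OF convex_mono_on_continuous[OF convex_C mono_C]])
    show "continuous_on ?S (\<lambda>x. \<Sum>e\<in>X. x e * real (s e))"
      by (intro continuous_intros coord)
    show "(\<lambda>x. \<Sum>e\<in>X. x e * real (s e)) ` ?S \<subseteq> {0..}"
      using nonneg by (auto intro!: sum_nonneg)
  qed
  then show "continuous_on ?S (frac_profit v s C X)"
    unfolding frac_profit_def by (intro continuous_intros coord)
qed

text \<open>As \<open>arg_max\<close> is a choice operator, \<open>opt_frac\<close> has its intended
  meaning only once a maximizer is known to exist.\<close>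

lemma opt_frac_is_arg_max:
  assumes "X \<subseteq> U"
  shows "is_arg_max (frac_profit v s C X) (\<lambda>x. x \<in> fractional_subsets (X \<inter> Int_elems))
           (opt_frac v s C U X)"
proof -
  have "\<exists>x. is_arg_max (frac_profit v s C X) (\<lambda>x. x \<in> fractional_subsets (X \<inter> Int_elems)) x"
    using frac_profit_attains_max[OF assms] unfolding is_arg_max_def by (meson not_less)
  from someI_ex[OF this] show ?thesis
    unfolding opt_frac_def arg_max_def .
qed

lemma opt_frac_mem: "X \<subseteq> U \<Longrightarrow> opt_frac v s C U X \<in> fractional_subsets (X \<inter> Int_elems)"
  using opt_frac_is_arg_max unfolding is_arg_max_def by blast

lemma frac_opt_upper:
  "X \<subseteq> U \<Longrightarrow> x \<in> fractional_subsets (X \<inter> Int_elems) \<Longrightarrow> frac_profit v s C X x \<le> frac_opt X"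
  using opt_frac_is_arg_max unfolding is_arg_max_def by (meson not_less)

lemma profit_le_frac_opt:
  assumes "X \<subseteq> U" and "A \<subseteq> X \<inter> Int_elems"
  shows "pr A \<le> frac_opt X"
proof -
  have X: "finite X" using assms(1) finite_U finite_subset by blast
  have AX: "X \<inter> A = A" using assms by auto
  let ?x = "\<lambda>e. if e \<in> A then 1 else 0 :: real"
  have "?x \<in> fractional_subsets (X \<inter> Int_elems)"
    using assms by (auto simp: fractional_subsets_def)
  then have "frac_profit v s C X ?x \<le> frac_opt X"
    using frac_opt_upper assms(1) by blast
  moreover have "frac_profit v s C X ?x = pr A"
  proof -
    have "(\<Sum>e\<in>X. ?x e * g e) = sum g A" for g :: "'a \<Rightarrow> real"
      using X AX by (simp add: if_distrib[of "\<lambda>z. z * _"] sum.If_cases cong: if_cong)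
    then show ?thesis by (simp add: frac_profit_def profit_def)
  qed
  ultimately show ?thesis by simp
qed

lemma frac_profit_superset:
  assumes "finite Y" and "X \<subseteq> Y" and "\<And>e. e \<notin> X \<Longrightarrow> x e = 0"
  shows "frac_profit v s C Y x = frac_profit v s C X x"
proof -
  have "(\<Sum>e\<in>Y. x e * g e) = (\<Sum>e\<in>X. x e * g e)" for g :: "'a \<Rightarrow> real"
    using assms by (intro sum.mono_neutral_right) auto
  then show ?thesis by (simp add: frac_profit_def)
qed

text \<open>A fractional optimum of \<open>X\<close>, extended by zero, competes in \<open>U\<close>
  with the same profit.\<close>

lemma frac_opt_mono:
  assumes "X \<subseteq> U"
  shows "frac_opt X \<le> frac_opt U"
proof -
  have x: "opt_frac v s C U X \<in> fractional_subsets (X \<inter> Int_elems)"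
    using opt_frac_mem assms by blast
  then have "frac_profit v s C U (opt_frac v s C U X) = frac_opt X"
    using assms finite_U by (intro frac_profit_superset) (auto simp: fractional_subsets_def)
  moreover have "opt_frac v s C U X \<in> fractional_subsets (U \<inter> Int_elems)"
    using x assms unfolding fractional_subsets_def by fastforce
  ultimately show ?thesis using frac_opt_upper[of U] by fastforce
qed

lemma opt_le_frac_opt_plus:
  assumes opt: "is_arg_max pr (\<lambda>A. A \<subseteq> U) Ostar"
    and M: "0 \<le> M" "\<And>e. e \<in> U \<Longrightarrow> pr {e} \<le> M"
  shows "pr Ostar \<le> frac_opt U + M"
proof -
  let ?F = "fractional_elems v s C U"
  have O: "Ostar \<subseteq> U" "finite Ostar"
    using opt finite_U finite_subset unfolding is_arg_max_def by blast+
  have max: "pr A \<le> pr Ostar" if "A \<subseteq> U" for A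
    using opt that unfolding is_arg_max_def by (meson not_less)
  \<comment> \<open>The rest of the optimum contains \<open>f\<close> and so has size at least
    \<open>s e\<close>; removing \<open>e\<close> would then raise the profit.\<close>
  have "\<not> (e \<noteq> f \<and> s e \<le> s f)" if "e \<in> Ostar \<inter> ?F" "f \<in> Ostar \<inter> ?F" for e f
  proof
    assume ef: "e \<noteq> f \<and> s e \<le> s f"
    have "s f \<le> sum s (Ostar - {e})" using that ef O by (intro member_le_sum) auto
    then have "real (s e) \<le> sum s (Ostar - {e})" using ef by linarith
    then have "v e < C (real (sum s (Ostar - {e})) + s e) - C (sum s (Ostar - {e}))"
      using fractional_elems_marginal that by blast
    then have "pr (insert e (Ostar - {e})) < pr (Ostar - {e})"
      using O by (subst profit_insert) auto
    moreover have "insert e (Ostar - {e}) = Ostar" using that by auto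
    ultimately show False using max[of "Ostar - {e}"] O by auto
  qed
  then have one: "e = f" if "e \<in> Ostar \<inter> ?F" "f \<in> Ostar \<inter> ?F" for e f
    using that by (metis linear)
  have le: "pr (Ostar \<inter> Int_elems) \<le> frac_opt U"
    using O by (intro profit_le_frac_opt) auto
  show ?thesis
  proof (cases "Ostar \<inter> ?F = {}")
    case True
    then have "Ostar \<inter> Int_elems = Ostar" using O by (auto simp: integral_elems_def)
    then show ?thesis using le M by simp
  next
    case False
    then obtain f where f: "f \<in> Ostar" "f \<in> ?F" by auto
    then have "Ostar = insert f (Ostar \<inter> Int_elems)"
      using O one by (auto simp: integral_elems_def)
    moreover have "f \<notin> Ostar \<inter> Int_elems" using f by (auto simp: integral_elems_def)
    ultimately have "pr Ostar \<le> pr (Ostar \<inter> Int_elems) + pr {f}"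
      using profit_insert_le O(2) by (metis finite_Int)
    then show ?thesis using le M(2)[of f] f O by auto
  qed
qed

section \<open>Greedy prefixes and their marginal weights\<close>

text \<open>An exchange argument shows that all but the last density in the support of a fractional
  optimum are taken completely; dropping the last element costs at most its own profit.\<close>

lemma greedy_prefix:
  assumes M: "0 \<le> M" "\<And>e. e \<in> U \<Longrightarrow> pr {e} \<le> M"
  obtains \<gamma> where "frac_opt U \<le> pr {e \<in> Int_elems. dens e > \<gamma>} + M"
    and "\<And>e. e \<in> Int_elems \<Longrightarrow> dens e > \<gamma> \<Longrightarrow>
           pr ({e \<in> Int_elems. dens e > \<gamma>} - {e}) \<le> pr {e \<in> Int_elems. dens e > \<gamma>}"
proof -
  define x where "x = opt_frac v s C U U"
  have UI: "U \<inter> Int_elems = Int_elems" using Int_elems_subset by auto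
  have x: "x \<in> fractional_subsets Int_elems"
    using opt_frac_mem[of U] UI by (simp add: x_def)
  have x01: "0 \<le> x e" "x e \<le> 1" for e
    using x unfolding fractional_subsets_def by (cases "e \<in> Int_elems", auto)+
  have x0: "x e = 0" if "e \<notin> Int_elems" for e
    using x that unfolding fractional_subsets_def by auto
  have upper: "frac_profit v s C U y \<le> frac_profit v s C U x" if "y \<in> fractional_subsets Int_elems" for y
    using frac_opt_upper[of U y] that UI by (simp add: x_def)
  define Z where "Z = {e \<in> Int_elems. x e > 0}"
  have finZ: "finite Z"
    using finite_U Int_elems_subset unfolding Z_def by (auto intro: finite_subset)
  show thesis
  proof (cases "Z = {}")
    case True
    then have "x e = 0" for e using x0 x01(1)[of e] unfolding Z_def by force
    then have F0: "frac_opt U = 0"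
      unfolding x_def[symmetric] by (simp add: frac_profit_def C_0)
    \<comment> \<open>An upper bound on all densities, so that the prefix above it is empty.\<close>
    define \<gamma> where "\<gamma> = (\<Sum>e\<in>U. \<bar>dens e\<bar>)"
    have "dens e \<le> \<gamma>" if "e \<in> U" for e
      using member_le_sum[of e U "\<lambda>e. \<bar>dens e\<bar>"] that finite_U unfolding \<gamma>_def by auto
    then have Q: "{e \<in> Int_elems. dens e > \<gamma>} = {}"
      using Int_elems_subset by force
    show thesis
    proof (rule that[of \<gamma>])
      show "frac_opt U \<le> pr {e \<in> Int_elems. dens e > \<gamma>} + M"
        unfolding Q using F0 M by (simp add: profit_empty)
    qed (use Q in blast)
  next
    case False
    then have "Min (dens ` Z) \<in> dens ` Z" using finZ by (intro Min_in) auto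
    then obtain f where f: "f \<in> Z" "dens f = Min (dens ` Z)" by auto
    have fmin: "dens f \<le> dens e" if "e \<in> Z" for e
      using that f finZ by auto
    have fI: "f \<in> Int_elems" "x f > 0" using f by (auto simp: Z_def)
    then have fU: "f \<in> U" using Int_elems_subset by auto
    define Q where "Q = {e \<in> Int_elems. dens e > dens f}"
    have QI: "Q \<subseteq> Int_elems" and QU: "Q \<subseteq> U" and fQ: "f \<notin> Q"
      using Int_elems_subset by (auto simp: Q_def)
    have finQ: "finite Q" using QU finite_U finite_subset by blast
    \<comment> \<open>If \<open>e\<close> were not taken completely, moving size from the less dense
      \<open>f\<close> to \<open>e\<close> would keep the cost and raise the value.\<close>
    have one: "x e = 1" if e: "e \<in> Q" for e
    proof (rule ccontr)
      assume "x e \<noteq> 1"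
      then have xe: "x e < 1" using x01(2)[of e] by simp
      have eU: "e \<in> U" "e \<in> Int_elems" "e \<noteq> f" using e QU QI fQ by auto
      have se: "real (s e) > 0" and sf: "real (s f) > 0" using size_pos eU fU by auto
      \<comment> \<open>The largest size that can be moved with both fractions staying in the unit
        interval.\<close>
      define h where "h = min ((1 - x e) * s e) (x f * s f)"
      have h: "h > 0" "h \<le> (1 - x e) * s e" "h \<le> x f * s f"
        using xe fI se sf by (auto simp: h_def)
      have hd: "h / s e > 0" "h / s e \<le> 1 - x e" "h / s f > 0" "h / s f \<le> x f"
        using h se sf by (auto simp: field_simps)
      define y where "y = (\<lambda>c. x c + (if c = e then h / s e else 0) + (if c = f then - (h / s f) else 0))"
      have "0 \<le> y c \<and> y c \<le> 1" for c
        using hd x01[of c] eU(3) by (auto simp: y_def)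
      moreover have "y c = 0" if "c \<notin> Int_elems" for c
        using that x0[of c] eU fI by (auto simp: y_def)
      ultimately have "y \<in> fractional_subsets Int_elems"
        by (simp add: fractional_subsets_def)
      then have le: "frac_profit v s C U y \<le> frac_profit v s C U x" by (rule upper)
      have sum_y: "(\<Sum>c\<in>U. y c * g c) = (\<Sum>c\<in>U. x c * g c) + h / s e * g e - h / s f * g f"
        for g :: "'a \<Rightarrow> real"
        using finite_U eU(1) fU
        by (simp add: y_def distrib_right sum.distrib if_distrib[of "\<lambda>z. z * _"] cong: if_cong)
      have "(\<Sum>c\<in>U. y c * s c) = (\<Sum>c\<in>U. x c * s c)"
        unfolding sum_y using se sf by simp
      then have "h / s e * v e - h / s f * v f \<le> 0"
        using le unfolding frac_profit_def sum_y[of v] by simp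
      moreover have "h / s e * v e - h / s f * v f = h * (dens e - dens f)"
        by (simp add: elem_density_def algebra_simps)
      moreover have "h * (dens e - dens f) > 0"
        using h e by (simp add: Q_def)
      ultimately show False by linarith
    qed
    \<comment> \<open>Any support element outside \<open>Q\<close> has the minimal density, and
      densities are distinct.\<close>
    have zero: "x c = 0" if "c \<notin> Q" "c \<noteq> f" for c
    proof (rule ccontr)
      assume "x c \<noteq> 0"
      then have c: "c \<in> Z" using x0[of c] x01(1)[of c] by (force simp: Z_def)
      then have "dens c = dens f" using fmin that by (force simp: Q_def Z_def)
      then show False using that c fU Int_elems_subset density_eq_iff[of c f] by (auto simp: Z_def)
    qed
    \<comment> \<open>The optimum with \<open>Q\<close> replaced by a subset \<open>Q'\<close> and
      the fraction of \<open>f\<close> kept, for comparison with the optimum itself.\<close>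
    define chi :: "'a set \<Rightarrow> 'a \<Rightarrow> real"
      where "chi = (\<lambda>Q' c. if c \<in> Q' then 1 else if c = f then x f else 0)"
    have x_chi: "x = chi Q"
      by (rule ext) (simp add: chi_def one zero)
    have chi: "frac_profit v s C U (chi Q') = sum v Q' + x f * v f - C (sum s Q' + x f * s f)"
      if "Q' \<subseteq> Q" for Q'
    proof -
      have sub: "Q' \<subseteq> U" "f \<notin> Q'" using that QU fQ by auto
      have "(\<Sum>c\<in>U. chi Q' c * g c) = sum g Q' + x f * g f" for g :: "'a \<Rightarrow> real"
      proof -
        have "(\<Sum>c\<in>U. chi Q' c * g c)
            = (\<Sum>c\<in>U. (if c \<in> Q' then g c else 0) + (if c = f then x f * g f else 0))"
          using sub(2) by (intro sum.cong) (auto simp: chi_def)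
        also have "\<dots> = sum g (U \<inter> Q') + x f * g f"
          using finite_U fU by (simp add: sum.distrib sum.If_cases)
        also have "U \<inter> Q' = Q'" using sub by auto
        finally show ?thesis .
      qed
      then show ?thesis by (simp add: frac_profit_def)
    qed
    have xf_s: "0 \<le> x f * s f" using x01 by simp
    show thesis
    proof (rule that[of "dens f"]; fold Q_def)
      have "frac_opt U = sum v Q + x f * v f - C (sum s Q + x f * s f)"
        using chi[of Q] x_chi unfolding x_def by simp
      \<comment> \<open>On top of \<open>Q\<close> the fraction of \<open>f\<close> costs at least
        as much as it does alone, so dropping it loses at most its own profit.\<close>
      moreover have "C (0 + x f * s f) - C 0 \<le> C (sum s Q + x f * s f) - C (sum s Q)"
        using xf_s by (intro convex_on_increment_mono[OF convex_C]) (simp_all del: of_nat_sum)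
      ultimately have "frac_opt U \<le> pr Q + (x f * v f - C (x f * s f))"
        by (simp add: profit_def C_0 del: of_nat_sum of_int_sum)
      also have "x f * v f - C (x f * s f) \<le> pr {f}"
        using Int_elems_fraction_le[OF fI(1)] x01 by blast
      also have "pr {f} \<le> M" using M fU by blast
      finally show "frac_opt U \<le> pr Q + M" by simp
    next
      \<comment> \<open>Optimality makes the marginal profit of \<open>e\<close> non-negative in the
        presence of the fraction of \<open>f\<close>; without that fraction the marginal cost of
        \<open>e\<close> is no larger.\<close>
      fix e assume "e \<in> Int_elems" "dens e > dens f"
      then have e: "e \<in> Q" by (simp add: Q_def)
      have "chi (Q - {e}) \<in> fractional_subsets Int_elems"
        using QI fI x01 by (auto simp: chi_def fractional_subsets_def)
      then have "frac_profit v s C U (chi (Q - {e})) \<le> frac_profit v s C U (chi Q)"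
        using upper x_chi by simp
      then have "sum v (Q - {e}) - C (sum s (Q - {e}) + x f * s f) \<le> sum v Q - C (sum s Q + x f * s f)"
        by (simp add: chi del: of_nat_sum of_int_sum)
      moreover have "C (real (sum s (Q - {e})) + s e) - C (sum s (Q - {e}))
          \<le> C (sum s (Q - {e}) + x f * s f + s e) - C (sum s (Q - {e}) + x f * s f)"
        using xf_s by (intro convex_on_increment_mono[OF convex_C]) (simp_all del: of_nat_sum)
      moreover have "real (sum s Q) = real (sum s (Q - {e})) + s e"
        using sum.remove[OF finQ e, of s] by simp
      ultimately show "pr (Q - {e}) \<le> pr Q"
        by (simp add: profit_def add_ac del: of_nat_sum of_int_sum)
    qed
  qed
qed

text \<open>The marginal profit of \<open>e\<close> when \<open>Q\<close> is built up by decreasing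
  density.\<close>

definition weight :: "'a set \<Rightarrow> 'a \<Rightarrow> real" where
  "weight Q e = pr (insert e {f \<in> Q. dens f > dens e}) - pr {f \<in> Q. dens f > dens e}"

text \<open>The weights telescope: ranking by \<open>- dens\<close> inserts the least dense element
  last, and all denser elements of \<open>Q\<close> are then already present.\<close>

lemma sum_weight_prefix:
  assumes "Q \<subseteq> U" and "P \<subseteq> Q"
    and "\<And>e f. e \<in> P \<Longrightarrow> f \<in> Q \<Longrightarrow> dens f > dens e \<Longrightarrow> f \<in> P"
  shows "sum (weight Q) P = pr P"
proof -
  have "finite P" using assms finite_U by (meson finite_subset)
  then show ?thesis using assms(2,3)
  proof (induction P rule: finite_ranking_induct[where f = "\<lambda>e. - dens e"])
    case empty
    then show ?case by (simp add: profit_empty)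
  next
    case (insert x P)
    show ?case
    proof (cases "x \<in> P")
      case True
      then show ?thesis using insert by (simp add: insert_absorb)
    next
      case False
      have gt: "dens f > dens x" if "f \<in> P" for f
      proof -
        have "f \<in> U" "x \<in> U" using insert.prems(1) that assms(1) by auto
        then have "dens f \<noteq> dens x" using density_eq_iff that False by blast
        then show ?thesis using insert.hyps(2)[OF that] by simp
      qed
      have "f \<in> P" if "e \<in> P" "f \<in> Q" "dens f > dens e" for e f
        using insert.prems(2)[of e f] that gt[of e] by auto
      then have IH: "sum (weight Q) P = pr P"
        using insert.IH insert.prems(1) by blast
      have "{f \<in> Q. dens f > dens x} = P"
        using insert.prems gt by auto
      then have "weight Q x = pr (insert x P) - pr P" by (simp add: weight_def)
      then show ?thesis using IH insert.hyps(1) False by simp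
    qed
  qed
qed

text \<open>In an arbitrary subset an element has fewer predecessors than in \<open>Q\<close>, so by
  diminishing returns its true marginal profit is at least its weight.\<close>

lemma sum_weight_le:
  assumes "Q \<subseteq> U" and "A \<subseteq> Q"
  shows "sum (weight Q) A \<le> pr A"
proof -
  have finQ: "finite Q" using assms finite_U by (meson finite_subset)
  then have "finite A" using assms finite_subset by auto
  then show ?thesis using assms(2)
  proof (induction A rule: finite_ranking_induct[where f = "\<lambda>e. - dens e"])
    case empty
    then show ?case by (simp add: profit_empty)
  next
    case (insert x A)
    show ?case
    proof (cases "x \<in> A")
      case True
      then show ?thesis using insert by (simp add: insert_absorb)
    next
      case False
      have "A \<subseteq> {f \<in> Q. dens f > dens x}"
      proof
        fix f assume f: "f \<in> A"
        then have "f \<in> U" "x \<in> U" using insert.prems assms(1) by auto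
        then have "dens f \<noteq> dens x" using density_eq_iff f False by blast
        then show "f \<in> {f \<in> Q. dens f > dens x}"
          using insert.hyps(2)[OF f] f insert.prems by auto
      qed
      then have "weight Q x \<le> pr (insert x A) - pr A"
        unfolding weight_def using finQ by (intro profit_marginal_antimono) auto
      then show ?thesis using insert False by simp
    qed
  qed
qed

lemma weight_le_profit:
  assumes "Q \<subseteq> U"
  shows "weight Q e \<le> pr {e}"
proof -
  have "finite Q" using assms finite_U by (meson finite_subset)
  then have "weight Q e \<le> pr (insert e {}) - pr {}"
    unfolding weight_def by (intro profit_marginal_antimono) auto
  then show ?thesis by (simp add: profit_empty)
qed

end

text \<open>Keeps only the second property of the greedy prefix; by diminishing returns,
  non-negative marginals at \<open>Q\<close> carry over to all of its subsets.\<close>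

locale greedy = convex_cost U v s C for U :: "'a set" and v s C +
  fixes \<gamma> :: real and Q :: "'a set"
  defines "Q \<equiv> {e \<in> Int_elems. dens e > \<gamma>}"
  assumes marginal: "\<And>e. e \<in> Q \<Longrightarrow> pr (Q - {e}) \<le> pr Q"
begin

lemma Q_subset: "Q \<subseteq> U" "Q \<subseteq> Int_elems"
  using Int_elems_subset by (auto simp: Q_def)

lemma finite_Q: "finite Q"
  using Q_subset finite_U finite_subset by blast

lemma profit_insert_ge:
  assumes "A \<subseteq> Q" and "e \<in> Q" "e \<notin> A"
  shows "pr A \<le> pr (insert e A)"
proof -
  have "pr (insert e (Q - {e})) - pr (Q - {e}) \<le> pr (insert e A) - pr A"
    using assms finite_Q by (intro profit_marginal_antimono) auto
  moreover have "insert e (Q - {e}) = Q" using assms by auto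
  ultimately show ?thesis using marginal[OF assms(2)] by simp
qed

lemma profit_mono:
  assumes "A \<subseteq> B" and "B \<subseteq> Q"
  shows "pr A \<le> pr B"
proof -
  have "finite (B - A)" using assms finite_Q by (meson finite_Diff finite_subset)
  then have "D \<subseteq> Q \<Longrightarrow> A \<inter> D = {} \<Longrightarrow> pr A \<le> pr (A \<union> D)" if "D = B - A" for D
    unfolding that[symmetric]
  proof (induction D rule: finite_induct)
    case (insert d D)
    then have "pr (A \<union> D) \<le> pr (insert d (A \<union> D))"
      using assms by (intro profit_insert_ge) auto
    then show ?case using insert by simp
  qed simp
  moreover have "A \<union> (B - A) = B" using assms by auto
  ultimately show ?thesis using assms by (metis Diff_disjoint Diff_subset order_trans)
qed

lemma weight_nonneg: "e \<in> Q \<Longrightarrow> 0 \<le> weight Q e"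
  unfolding weight_def using profit_insert_ge[of "{f \<in> Q. dens f > dens e}" e] by auto

lemma sum_weight_eq: "sum (weight Q) {e \<in> Q. dens e \<ge> \<tau>} = pr {e \<in> Q. dens e \<ge> \<tau>}"
  using Q_subset by (intro sum_weight_prefix) auto

lemma sum_weight_Q: "sum (weight Q) Q = pr Q"
  using Q_subset by (intro sum_weight_prefix) auto

end

section \<open>The threshold rule\<close>

context convex_cost
begin

text \<open>Accepted elements have non-negative marginal profit. So the output never has negative
  profit, even for unfavourable samples.\<close>

lemma fold_online_step_profit_ge: "pr S \<le> pr (fold (online_step v s C U \<tau>) ys S)"
proof (induction ys arbitrary: S)
  case (Cons y ys)
  have "pr S \<le> pr (online_step v s C U \<tau> y S)" by (simp add: online_step_def)
  then show ?case using Cons[of "online_step v s C U \<tau> y S"] by simp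
qed simp

lemma threshold_rule_nonneg: "0 \<le> pr (threshold_rule v s C k\<^sub>1 \<beta> U xs k)"
  using fold_online_step_profit_ge[of "{}"] by (simp add: threshold_rule_def Let_def profit_empty)

end

context greedy
begin

text \<open>Inside \<open>Q\<close> the profit test always succeeds, so the rule reduces to a
  density filter and the arrival order no longer matters.\<close>

lemma fold_online_step:
  assumes "{e \<in> Int_elems. dens e \<ge> \<tau>} \<subseteq> Q"
    and "distinct ys" "set ys \<subseteq> U" and "S \<subseteq> Q" "S \<inter> set ys = {}"
  shows "fold (online_step v s C U \<tau>) ys S = S \<union> {e \<in> set ys \<inter> Int_elems. dens e \<ge> \<tau>}"
  using assms(2-)
proof (induction ys arbitrary: S)
  case (Cons y ys)
  show ?case
  proof (cases "y \<in> Int_elems \<and> dens y \<ge> \<tau>")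
    case True
    then have y: "y \<in> Q" "y \<notin> S" "y \<notin> fractional_elems v s C U"
      using assms(1) Cons.prems by (auto simp: integral_elems_def)
    then have "online_step v s C U \<tau> y S = insert y S"
      using True profit_insert_ge[of S y] Cons.prems by (simp add: online_step_def)
    moreover have "fold (online_step v s C U \<tau>) ys (insert y S)
        = insert y S \<union> {e \<in> set ys \<inter> Int_elems. dens e \<ge> \<tau>}"
      using Cons.prems y by (intro Cons.IH) auto
    ultimately show ?thesis using True by auto
  next
    case False
    then have "online_step v s C U \<tau> y S = S"
      using Cons.prems by (auto simp: online_step_def integral_elems_def)
    moreover have "fold (online_step v s C U \<tau>) ys S
        = S \<union> {e \<in> set ys \<inter> Int_elems. dens e \<ge> \<tau>}"
      using Cons.prems by (intro Cons.IH) auto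
    ultimately show ?thesis using False by auto
  qed
qed simp

text \<open>Finitely many prefixes occur, each cut off at the density of a member; the largest such
  cut-off that still reaches weight \<open>c\<close> gives \<open>R\<close>.\<close>

lemma smallest_prefix:
  assumes "0 < c" and "c \<le> sum (weight Q) Q"
  obtains R where "R \<subseteq> Q" and "c \<le> sum (weight Q) R"
    and "\<And>\<tau>. c \<le> sum (weight Q) {e \<in> Q. dens e \<ge> \<tau>} \<Longrightarrow> R \<subseteq> {e \<in> Q. dens e \<ge> \<tau>}"
proof -
  define G where "G = {g \<in> dens ` Q. c \<le> sum (weight Q) {e \<in> Q. dens e \<ge> g}}"
  have finG: "finite G" using finite_Q by (simp add: G_def)
  \<comment> \<open>Raising the threshold to the least density in its prefix does not change the
    prefix, which is non-empty because \<open>c\<close> is positive.\<close>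
  have G: "\<exists>g\<in>G. {e \<in> Q. dens e \<ge> g} = {e \<in> Q. dens e \<ge> \<tau>}"
    if c: "c \<le> sum (weight Q) {e \<in> Q. dens e \<ge> \<tau>}" for \<tau>
  proof -
    let ?P = "{e \<in> Q. dens e \<ge> \<tau>}"
    have "?P \<noteq> {}" using c assms(1) by (metis not_less sum.empty)
    then have m: "Min (dens ` ?P) \<in> dens ` ?P" using finite_Q by (intro Min_in) auto
    have le: "Min (dens ` ?P) \<le> dens e" if "e \<in> ?P" for e
      using that finite_Q by (intro Min_le) auto
    have "{e \<in> Q. dens e \<ge> Min (dens ` ?P)} = ?P"
      using m le by force
    then show ?thesis using m c unfolding G_def by (intro bexI[of _ "Min (dens ` ?P)"]) auto
  qed
  have "Q = {e \<in> Q. dens e \<ge> \<gamma>}" by (auto simp: Q_def)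
  then have "G \<noteq> {}" using G[of \<gamma>] assms(2) by auto
  then have max: "Max G \<in> G" using finG by simp
  show thesis
  proof (rule that[of "{e \<in> Q. dens e \<ge> Max G}"])
    show "c \<le> sum (weight Q) {e \<in> Q. dens e \<ge> Max G}" using max by (simp add: G_def)
    fix \<tau> assume "c \<le> sum (weight Q) {e \<in> Q. dens e \<ge> \<tau>}"
    then obtain g where g: "g \<in> G" "{e \<in> Q. dens e \<ge> g} = {e \<in> Q. dens e \<ge> \<tau>}"
      using G by blast
    have "g \<le> Max G" using g finG by simp
    then show "{e \<in> Q. dens e \<ge> Max G} \<subseteq> {e \<in> Q. dens e \<ge> \<tau>}"
      using g(2) by force
  qed auto
qed

lemma threshold_rule_ge:
  fixes k\<^sub>1 \<beta> :: real
  defines "B \<equiv> \<beta> * (1 - 1 / k\<^sub>1)"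
  assumes B: "0 < B" and F: "0 < frac_opt U"
    and xs: "xs \<in> permutations_of_set U"
    and good: "B * frac_opt U \<le> sum (weight Q) (Q \<inter> set (take k xs))"
    and R: "R \<subseteq> Q"
      "\<And>\<tau>. B\<^sup>2 * frac_opt U \<le> sum (weight Q) {e \<in> Q. dens e \<ge> \<tau>} \<Longrightarrow> R \<subseteq> {e \<in> Q. dens e \<ge> \<tau>}"
  shows "sum (weight Q) (R \<inter> set (drop k xs)) \<le> pr (threshold_rule v s C k\<^sub>1 \<beta> U xs k)"
proof -
  define X where "X = set (take k xs)"
  define Y where "Y = set (drop k xs)"
  define \<Theta> where "\<Theta> = thresholds v s C k\<^sub>1 \<beta> U X"
  have xs': "set xs = U" "distinct xs" using xs permutations_of_setD by auto
  have XU: "X \<subseteq> U" "finite X" and YU: "Y \<subseteq> U"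
    using xs' by (auto simp: X_def Y_def dest: in_set_takeD in_set_dropD)
  have prQX: "B * frac_opt U \<le> pr (Q \<inter> X)"
    using good sum_weight_le[of Q "Q \<inter> X"] Q_subset by (simp add: X_def)
  moreover have "0 < B * frac_opt U" using B F by simp
  ultimately have "Q \<inter> X \<noteq> {}" using profit_empty by force
  then have "Min (dens ` (Q \<inter> X)) \<in> dens ` (Q \<inter> X)" using XU by (intro Min_in) auto
  then obtain e\<^sub>0 where e\<^sub>0: "e\<^sub>0 \<in> Q" "e\<^sub>0 \<in> X" "dens e\<^sub>0 = Min (dens ` (Q \<inter> X))" by auto
  have min: "dens e\<^sub>0 \<le> dens e" if "e \<in> Q \<inter> X" for e
    using e\<^sub>0(3) that XU by auto
  \<comment> \<open>The least dense sampled element of \<open>Q\<close> is therefore a candidate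
    threshold. So the chosen threshold exceeds \<open>\<gamma>\<close>, and the rule accepts only
    elements of \<open>Q\<close>.\<close>
  have "density_prefix v s (X \<inter> Int_elems) (dens e\<^sub>0) = Q \<inter> X"
    using min e\<^sub>0 unfolding density_prefix_def Q_def by force
  moreover have "B * frac_opt X \<le> pr (Q \<inter> X)"
    using prQX frac_opt_mono[OF XU(1)] B by (smt (verit) mult_left_mono)
  ultimately have "dens e\<^sub>0 \<in> \<Theta>"
    using e\<^sub>0(2) by (auto simp: \<Theta>_def thresholds_def B_def)
  moreover have "finite \<Theta>" using XU by (simp add: \<Theta>_def thresholds_def)
  ultimately have ne: "\<Theta> \<noteq> {}" and max: "Max \<Theta> \<in> \<Theta>" "dens e\<^sub>0 \<le> Max \<Theta>"
    by (auto intro: Max_in)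
  let ?P = "{e \<in> Q. dens e \<ge> Max \<Theta>}"
  have P: "{e \<in> Int_elems. dens e \<ge> Max \<Theta>} = ?P"
    using max(2) e\<^sub>0(1) by (auto simp: Q_def)
  then have "density_prefix v s (X \<inter> Int_elems) (Max \<Theta>) = ?P \<inter> X"
    by (auto simp: density_prefix_def)
  then have "B * frac_opt X \<le> pr (?P \<inter> X)"
    using max(1) by (simp add: \<Theta>_def thresholds_def B_def)
  \<comment> \<open>The second factor \<open>B\<close> appears because the threshold is measured
    against the optimum of the sample, which is at least \<open>B * frac_opt U\<close>.\<close>
  moreover have "B * (B * frac_opt U) \<le> B * frac_opt X"
  proof (rule mult_left_mono)
    have "pr (Q \<inter> X) \<le> frac_opt X"
      using Q_subset by (intro profit_le_frac_opt[OF XU(1)]) auto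
    then show "B * frac_opt U \<le> frac_opt X" using prQX by simp
  qed (use B in simp)
  moreover have "pr (?P \<inter> X) \<le> pr ?P" by (rule profit_mono) auto
  ultimately have "B\<^sup>2 * frac_opt U \<le> sum (weight Q) ?P"
    by (simp add: sum_weight_eq power2_eq_square)
  \<comment> \<open>The threshold depends on the sample, but \<open>R\<close> does not; this allows
    averaging over the later part of \<open>R\<close>.\<close>
  then have RP: "R \<subseteq> ?P" by (rule R(2))
  have "threshold_rule v s C k\<^sub>1 \<beta> U xs k = fold (online_step v s C U (Max \<Theta>)) (drop k xs) {}"
    using ne by (simp add: threshold_rule_def \<Theta>_def X_def)
  also have "\<dots> = {e \<in> Y \<inter> Int_elems. dens e \<ge> Max \<Theta>}"
    using P xs' YU by (subst fold_online_step) (auto simp: Y_def)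
  also have "\<dots> = ?P \<inter> Y" using P by auto
  finally have out: "threshold_rule v s C k\<^sub>1 \<beta> U xs k = ?P \<inter> Y" .
  have "sum (weight Q) (R \<inter> Y) \<le> sum (weight Q) (?P \<inter> Y)"
    using RP finite_Q weight_nonneg by (intro sum_mono2) auto
  also have "\<dots> \<le> pr (?P \<inter> Y)" using Q_subset by (intro sum_weight_le) auto
  finally show ?thesis using out by (simp add: Y_def)
qed

text \<open>The indicator of the bad event is bounded by a multiple of the squared deviation, as in the
  proof of Chebyshev's inequality.\<close>

lemma threshold_rule_chebyshev:
  fixes k\<^sub>1 \<beta> :: real
  defines "B \<equiv> \<beta> * (1 - 1 / k\<^sub>1)"
  assumes B: "0 < B" and F: "0 < frac_opt U"
    and xs: "xs \<in> permutations_of_set U"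
    and d: "0 < d" "d \<le> pr Q / 2 - B * frac_opt U"
    and R: "R \<subseteq> Q"
      "\<And>\<tau>. B\<^sup>2 * frac_opt U \<le> sum (weight Q) {e \<in> Q. dens e \<ge> \<tau>} \<Longrightarrow> R \<subseteq> {e \<in> Q. dens e \<ge> \<tau>}"
  shows "sum (weight Q) R - prefix_weight (weight Q) R k xs
      - sum (weight Q) R / d\<^sup>2 * (prefix_weight (weight Q) Q k xs - pr Q / 2)\<^sup>2
      \<le> pr (threshold_rule v s C k\<^sub>1 \<beta> U xs k)"
proof -
  let ?w = "weight Q" and ?X = "set (take k xs)"
  have finR: "finite R" using R(1) finite_Q finite_subset by blast
  have wR: "0 \<le> sum ?w R" using R(1) weight_nonneg by (intro sum_nonneg) auto
  have xs': "set xs = U" "distinct xs" using xs permutations_of_setD by auto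
  have "U = ?X \<union> set (drop k xs)" "?X \<inter> set (drop k xs) = {}"
    using xs' by (metis append_take_drop_id set_append,
        metis append_take_drop_id distinct_append)
  then have "R - R \<inter> ?X = R \<inter> set (drop k xs)"
    using R(1) Q_subset by auto
  then have diff: "sum ?w R - prefix_weight ?w R k xs = sum ?w (R \<inter> set (drop k xs))"
    using sum_diff[of R "R \<inter> ?X" ?w] finR by (simp add: prefix_weight_eq)
  show ?thesis
  proof (cases "B * frac_opt U \<le> sum ?w (Q \<inter> ?X)")
    case True
    have "sum ?w (R \<inter> set (drop k xs)) \<le> pr (threshold_rule v s C k\<^sub>1 \<beta> U xs k)"
      using threshold_rule_ge B F xs True R unfolding B_def by blast
    moreover have "0 \<le> sum ?w R / d\<^sup>2 * (prefix_weight ?w Q k xs - pr Q / 2)\<^sup>2"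
      using wR by simp
    ultimately show ?thesis using diff by linarith
  next
    \<comment> \<open>In a bad sample the deviation is at least \<open>d\<close>, so the subtracted
      term exceeds the whole weight of \<open>R\<close> and the left side is at most 0.\<close>
    case False
    then have "d \<le> pr Q / 2 - prefix_weight ?w Q k xs"
      using d finite_Q by (simp add: prefix_weight_eq)
    then have "d\<^sup>2 \<le> (prefix_weight ?w Q k xs - pr Q / 2)\<^sup>2"
      using d(1) by (subst power2_commute) (intro power_mono, auto)
    then have "sum ?w R / d\<^sup>2 * d\<^sup>2 \<le> sum ?w R / d\<^sup>2 * (prefix_weight ?w Q k xs - pr Q / 2)\<^sup>2"
      using wR by (intro mult_left_mono) auto
    then have "sum ?w R \<le> sum ?w R / d\<^sup>2 * (prefix_weight ?w Q k xs - pr Q / 2)\<^sup>2"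
      using d(1) by simp
    moreover have "0 \<le> prefix_weight ?w R k xs"
      using finR R(1) weight_nonneg by (auto simp: prefix_weight_eq intro!: sum_nonneg)
    ultimately show ?thesis
      using threshold_rule_nonneg[of k\<^sub>1 \<beta> xs k] by linarith
  qed
qed

end

context convex_cost
begin

lemma threshold_rule_mean:
  assumes M: "0 \<le> M" "\<And>e. e \<in> U \<Longrightarrow> pr {e} \<le> M"
    and F: "0 < frac_opt U" "20 * M \<le> frac_opt U"
  shows "frac_opt U / 100 \<le> sample_mean U (\<lambda>k xs. pr (threshold_rule v s C 112 0.262 U xs k))"
proof -
  define F where "F = frac_opt U"
  have Fpos: "0 < F" and MF: "M \<le> F / 20" using F by (auto simp: F_def)
  define B :: real where "B = 0.262 * (1 - 1 / 112)"
  have B: "0 < B" "1 / 4 \<le> B" "B \<le> 13 / 50" by (simp_all add: B_def)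
  obtain \<gamma> where \<gamma>: "frac_opt U \<le> pr {e \<in> Int_elems. dens e > \<gamma>} + M"
    "\<And>e. e \<in> Int_elems \<Longrightarrow> dens e > \<gamma> \<Longrightarrow>
       pr ({e \<in> Int_elems. dens e > \<gamma>} - {e}) \<le> pr {e \<in> Int_elems. dens e > \<gamma>}"
    using greedy_prefix[OF M] by blast
  define Q where "Q = {e \<in> Int_elems. dens e > \<gamma>}"
  interpret greedy U v s C \<gamma> Q
    using \<gamma>(2) by unfold_locales (auto simp: Q_def)
  let ?w = "weight Q"
  have QF: "19 / 20 * F \<le> pr Q" "pr Q \<le> F"
    using \<gamma>(1) MF profit_le_frac_opt[of U Q] Q_subset by (auto simp: Q_def F_def)
  \<comment> \<open>Here 43/200 is 19/40 - 13/50: half the lower bound on \<open>pr Q\<close> minus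
    the upper bound on \<open>B * F\<close>.\<close>
  define d where "d = 43 / 200 * F"
  have BF: "B * F \<le> 13 / 50 * F" using B Fpos by (intro mult_right_mono) auto
  then have d: "0 < d" "d \<le> pr Q / 2 - B * F"
    using QF Fpos unfolding d_def by linarith+
  have B2: "3 / 50 \<le> B\<^sup>2" "B\<^sup>2 \<le> 7 / 100"
    using power_mono[of "1 / 4" B 2] power_mono[of B "13 / 50" 2] B by (auto simp: power2_eq_square)
  have B2F: "3 / 50 * F \<le> B\<^sup>2 * F" "B\<^sup>2 * F \<le> 7 / 100 * F"
    using B2 Fpos by (auto intro: mult_right_mono)
  have c: "0 < B\<^sup>2 * F" "B\<^sup>2 * F \<le> sum ?w Q"
    using B2F QF Fpos sum_weight_Q by linarith+
  obtain R where R: "R \<subseteq> Q" "B\<^sup>2 * F \<le> sum ?w R"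
    "\<And>\<tau>. B\<^sup>2 * F \<le> sum ?w {e \<in> Q. dens e \<ge> \<tau>} \<Longrightarrow> R \<subseteq> {e \<in> Q. dens e \<ge> \<tau>}"
    by (rule smallest_prefix[OF c], rule that)
  have "?w e \<le> M" if "e \<in> Q" for e
    using that weight_le_profit[of Q e] M(2)[of e] Q_subset by auto
  \<comment> \<open>Small weights keep the variance small: the sum of squares is at most the largest
    weight times the total.\<close>
  then have "(\<Sum>e\<in>Q. (?w e)\<^sup>2) \<le> (\<Sum>e\<in>Q. M * ?w e)"
    unfolding power2_eq_square using weight_nonneg by (intro sum_mono mult_right_mono) auto
  also have "\<dots> = M * pr Q" by (simp add: sum_weight_Q flip: sum_distrib_left)
  also have "\<dots> \<le> F / 20 * F" using MF QF M(1) Fpos by (intro mult_mono) auto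
  finally have "(\<Sum>e\<in>Q. (?w e)\<^sup>2) / 4 \<le> F * F / 80" by simp
  also have "\<dots> \<le> 7 / 25 * d\<^sup>2"
    using Fpos by (simp add: d_def power2_eq_square)
  finally have var: "(\<Sum>e\<in>Q. (?w e)\<^sup>2) / 4 / d\<^sup>2 \<le> 7 / 25"
    using d(1) by (simp add: divide_le_eq)
  let ?Z = "\<lambda>k xs. (prefix_weight ?w Q k xs - sum ?w Q / 2)\<^sup>2"
  \<comment> \<open>The factor 11/50 is 1/2 - 7/25, the average late share of \<open>R\<close> minus
    the Chebyshev loss.\<close>
  have "F / 100 \<le> 3 / 50 * F * (11 / 50)" using Fpos by simp
  also have "\<dots> \<le> sum ?w R * (1 / 2 - (\<Sum>e\<in>Q. (?w e)\<^sup>2) / 4 / d\<^sup>2)"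
  proof (rule mult_mono)
    show "3 / 50 * F \<le> sum ?w R" using B2F(1) R(2) by linarith
    then show "0 \<le> sum ?w R" using Fpos by linarith
    show "11 / 50 \<le> 1 / 2 - (\<Sum>e\<in>Q. (?w e)\<^sup>2) / 4 / d\<^sup>2" using var by linarith
  qed simp
  \<comment> \<open>Differences become sums with negative factors, to match the linearity
    rules.\<close>
  also have "\<dots> = sum ?w R + ((- 1) * (sum ?w R / 2) + (- (sum ?w R / d\<^sup>2)) * ((\<Sum>e\<in>Q. (?w e)\<^sup>2) / 4))"
    by (simp add: algebra_simps)
  also have "\<dots> = sample_mean U (\<lambda>k xs. sum ?w R + ((- 1) * prefix_weight ?w R k xs
      + (- (sum ?w R / d\<^sup>2)) * ?Z k xs))"
    using finite_U Q_subset(1) R(1)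
    by (simp only: sample_mean_add sample_mean_cmult sample_mean_const
        sample_mean_prefix_weight[OF finite_U order_trans[OF R(1) Q_subset(1)]]
        sample_variance_prefix_weight[OF finite_U Q_subset(1)])
  also have "\<dots> \<le> sample_mean U (\<lambda>k xs. pr (threshold_rule v s C 112 0.262 U xs k))"
  proof (rule sample_mean_mono)
    fix k xs assume "xs \<in> permutations_of_set U"
    then have "sum ?w R - prefix_weight ?w R k xs
      - sum ?w R / d\<^sup>2 * (prefix_weight ?w Q k xs - pr Q / 2)\<^sup>2
      \<le> pr (threshold_rule v s C 112 0.262 U xs k)"
      using B d R Fpos unfolding B_def F_def by (intro threshold_rule_chebyshev) auto
    then show "sum ?w R + ((- 1) * prefix_weight ?w R k xs + (- (sum ?w R / d\<^sup>2)) * ?Z k xs)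
      \<le> pr (threshold_rule v s C 112 0.262 U xs k)"
      by (simp add: sum_weight_Q)
  qed
  finally show ?thesis by (simp add: F_def)
qed

end

section \<open>The secretary rule\<close>

lemma exceeds_trans:
  "exceeds v s C t e f \<Longrightarrow> exceeds v s C t f g \<Longrightarrow> exceeds v s C t e g"
  by (auto simp: exceeds_def)

lemma exceeds_asym: "exceeds v s C t e f \<Longrightarrow> \<not> exceeds v s C t f e"
  by (auto simp: exceeds_def)

lemma exceeds_total:
  "inj_on t A \<Longrightarrow> e \<in> A \<Longrightarrow> f \<in> A \<Longrightarrow> e \<noteq> f \<Longrightarrow> exceeds v s C t e f \<or> exceeds v s C t f e"
  unfolding exceeds_def by (metis inj_onD linorder_neqE)

lemma exceeds_maximum:
  assumes "finite A" and "A \<noteq> {}" and "inj_on t A"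
  shows "\<exists>b\<in>A. \<forall>e\<in>A - {b}. exceeds v s C t b e"
  using assms
proof (induction A rule: finite_ne_induct)
  case (insert x A)
  then obtain b where b: "b \<in> A" "\<forall>e\<in>A - {b}. exceeds v s C t b e" by auto
  have "exceeds v s C t x b \<or> exceeds v s C t b x"
    using insert b by (intro exceeds_total[of t "insert x A"]) auto
  then show ?case
  proof
    assume x: "exceeds v s C t x b"
    then have "exceeds v s C t x e" if "e \<in> A" for e
      using that b(2) by (cases "e = b") (auto intro: exceeds_trans)
    then show ?thesis by blast
  next
    assume "exceeds v s C t b x"
    then show ?thesis using b by blast
  qed
qed simp

lemma dynkin_eqI:
  assumes "i < length xs" and "nat \<lfloor>real (length xs) / exp 1\<rfloor> \<le> i"
    and "0 \<le> profit v s C {xs ! i}" and "\<And>j. j < i \<Longrightarrow> exceeds v s C t (xs ! i) (xs ! j)"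
    and "\<And>j. nat \<lfloor>real (length xs) / exp 1\<rfloor> \<le> j \<Longrightarrow> j < i \<Longrightarrow> \<exists>l<j. \<not> exceeds v s C t (xs ! j) (xs ! l)"
  shows "dynkin v s C t xs = {xs ! i}"
proof -
  have "find (\<lambda>i. nat \<lfloor>real (length xs) / exp 1\<rfloor> \<le> i \<and> 0 \<le> profit v s C {xs ! i} \<and>
                     (\<forall>j<i. exceeds v s C t (xs ! i) (xs ! j))) [0..<length xs] = Some i"
    unfolding find_Some_iff using assms by (intro exI[of _ i]) auto
  then show ?thesis by (simp add: dynkin_def)
qed

context convex_cost
begin

lemma dynkin_nonneg: "0 \<le> pr (dynkin v s C t xs)"
  unfolding dynkin_def by (auto simp: profit_empty find_Some_iff split: option.split)

lemma dynkin_first: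
  assumes "xs \<in> permutations_of_set U" and "b \<in> U" and "0 \<le> pr {b}"
    and "nat \<lfloor>real (card U) / exp 1\<rfloor> = 0" and "b \<in> set (take 1 xs)"
  shows "dynkin v s C t xs = {b}"
proof -
  have len: "length xs = card U" using assms length_finite_permutations_of_set by blast
  have "xs \<noteq> []" "xs ! 0 = b" using assms(5) by (cases xs; auto)+
  moreover from this have "dynkin v s C t xs = {xs ! 0}"
    using assms(3,4) len by (intro dynkin_eqI) (auto simp flip: length_greater_0_conv)
  ultimately show ?thesis by simp
qed

text \<open>With the second best element \<open>c\<close> rejected, nothing that arrives before
  \<open>b\<close> and after \<open>c\<close> can be a record, so the search stops at
  \<open>b\<close>.\<close>

lemma dynkin_best:
  assumes xs: "xs \<in> permutations_of_set U" and "b \<in> U" and "0 \<le> pr {b}"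
    and best: "\<And>e. e \<in> U \<Longrightarrow> e \<noteq> b \<Longrightarrow> exceeds v s C t b e"
    and second: "\<And>e. e \<in> U \<Longrightarrow> e \<noteq> b \<Longrightarrow> e \<noteq> c \<Longrightarrow> exceeds v s C t c e"
    and r: "r = nat \<lfloor>real (card U) / exp 1\<rfloor>"
    and cb: "c \<in> set (take r xs)" "b \<notin> set (take r xs)"
  shows "dynkin v s C t xs = {b}"
proof -
  have xs': "set xs = U" "distinct xs" "length xs = card U"
    using xs permutations_of_setD length_finite_permutations_of_set by metis+
  obtain i where i: "i < length xs" "xs ! i = b"
    using assms(2) xs'(1) by (metis in_set_conv_nth)
  have ri: "r \<le> i" using cb(2) i by (metis in_set_conv_nth length_take min_less_iff_conj not_le nth_take)
  obtain l where l: "l < r" "l < length xs" "xs ! l = c"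
    using cb(1) by (auto simp: in_set_conv_nth)
  have "dynkin v s C t xs = {xs ! i}"
  proof (rule dynkin_eqI)
    show "exceeds v s C t (xs ! i) (xs ! j)" if "j < i" for j
      using that i xs' best[of "xs ! j"] by (metis nth_eq_iff_index_eq nth_mem less_irrefl less_trans)
    show "\<exists>l<j. \<not> exceeds v s C t (xs ! j) (xs ! l)"
      if j: "nat \<lfloor>real (length xs) / exp 1\<rfloor> \<le> j" "j < i" for j
    proof -
      have lj: "l < j" using l j r xs'(3) by simp
      have "xs ! j \<noteq> b" "xs ! j \<noteq> c"
        using i l lj j(2) xs'(2) by (metis nth_eq_iff_index_eq less_irrefl less_trans)+
      then have "exceeds v s C t c (xs ! j)"
        using second xs'(1) i(1) j(2) by auto
      then show ?thesis using lj l exceeds_asym by metis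
    qed
  qed (use i ri r xs' assms(3) in auto)
  then show ?thesis using i by simp
qed

lemma dynkin_sum_ge:
  assumes "U \<noteq> {}" and "inj_on t U"
  obtains b where "b \<in> U" and "\<And>e. e \<in> U \<Longrightarrow> pr {e} \<le> pr {b}"
    and "pr {b} / 12 \<le> (\<Sum>xs\<in>permutations_of_set U. pr (dynkin v s C t xs)) / fact (card U)"
proof -
  obtain b where b: "b \<in> U" "\<forall>e\<in>U - {b}. exceeds v s C t b e"
    using exceeds_maximum[OF finite_U assms] by blast
  have b_max: "pr {e} \<le> pr {b}" if "e \<in> U" for e
    using b(2) that unfolding exceeds_def by (cases "e = b") (auto dest!: bspec[of _ _ e])
  define n where "n = card U"
  define r where "r = nat \<lfloor>real n / exp 1\<rfloor>"
  have n: "n > 0" using assms(1) finite_U by (simp add: n_def card_gt_0_iff)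
  \<comment> \<open>These crude bounds are enough to place the cut-off \<open>r\<close> above
    \<open>n / 3 - 1\<close> and at most at \<open>n / 2\<close>.\<close>
  have e: "2 \<le> exp (1::real)" "exp (1::real) \<le> 3"
    using exp_ge_add_one_self[of 1] exp_le by auto
  have r_upper: "real r \<le> real n / 2"
  proof -
    have "real r \<le> real n / exp 1" unfolding r_def by simp
    also have "\<dots> \<le> real n / 2" using e by (intro divide_left_mono) auto
    finally show ?thesis .
  qed
  have r_lower: "real n / 3 < real r + 1"
  proof -
    have "real n / 3 \<le> real n / exp 1" using e by (intro divide_left_mono) auto
    also have "\<dots> < real r + 1" unfolding r_def by linarith
    finally show ?thesis .
  qed
  have "pr {b} / 12 \<le> (\<Sum>xs\<in>permutations_of_set U. pr (dynkin v s C t xs)) / fact n"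
  proof (cases "0 \<le> pr {b}")
    case False
    have "0 \<le> (\<Sum>xs\<in>permutations_of_set U. pr (dynkin v s C t xs))"
      by (intro sum_nonneg dynkin_nonneg)
    then have "0 \<le> (\<Sum>xs\<in>permutations_of_set U. pr (dynkin v s C t xs)) / fact n" by simp
    then show ?thesis using False by linarith
  next
    case nonneg: True
    show ?thesis
    proof (cases "r = 0")
      case True
      \<comment> \<open>With no rejection phase, the best element is chosen if it arrives first,
        which has probability \<open>1 / n\<close>.\<close>
      have n2: "real n \<le> 2" using r_lower True by simp
      have "(\<Sum>xs\<in>permutations_of_set U. pr {b} * in_prefix 1 xs b)
          \<le> (\<Sum>xs\<in>permutations_of_set U. pr (dynkin v s C t xs))"
      proof (rule sum_mono)
        fix xs assume "xs \<in> permutations_of_set U"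
        then show "pr {b} * in_prefix 1 xs b \<le> pr (dynkin v s C t xs)"
          using dynkin_first[of xs b t] b(1) nonneg True dynkin_nonneg[of t xs]
          by (simp add: in_prefix_def r_def n_def)
      qed
      also have "(\<Sum>xs\<in>permutations_of_set U. pr {b} * in_prefix 1 xs b) = pr {b} * (fact n / n)"
        using sum_permutations_in_prefix[OF finite_U _ b(1), of 1] n
        unfolding sum_distrib_left[symmetric] by (simp add: n_def eq_divide_eq)
      finally have "pr {b} * (1 / n) \<le> (\<Sum>xs\<in>permutations_of_set U. pr (dynkin v s C t xs)) / fact n"
        by (simp add: field_simps)
      moreover have "pr {b} * (1 / 12) \<le> pr {b} * (1 / n)"
        using nonneg n n2 by (intro mult_left_mono divide_left_mono) auto
      ultimately show ?thesis by linarith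
    next
      case False
      then have r1: "1 \<le> real r" by simp
      then have n2: "real n \<ge> 2" using r_upper by simp
      have "U - {b} \<noteq> {}"
      proof
        assume "U - {b} = {}"
        then have "U = {b}" using b by auto
        then show False using n2 by (simp add: n_def)
      qed
      then obtain c where c: "c \<in> U" "c \<noteq> b" "\<forall>e\<in>U - {b} - {c}. exceeds v s C t c e"
        using exceeds_maximum[of "U - {b}" t v s C] finite_U assms(2)
        by (auto intro: inj_on_subset)
      \<comment> \<open>The indicator that the second best element \<open>c\<close> is rejected and
        the best element \<open>b\<close> is not.\<close>
      let ?g = "\<lambda>xs. in_prefix r xs c - in_prefix r xs c * in_prefix r xs b"
      have "(\<Sum>xs\<in>permutations_of_set U. pr {b} * ?g xs)
          \<le> (\<Sum>xs\<in>permutations_of_set U. pr (dynkin v s C t xs))"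
      proof (rule sum_mono)
        fix xs assume xs: "xs \<in> permutations_of_set U"
        have "dynkin v s C t xs = {b}" if "c \<in> set (take r xs)" "b \<notin> set (take r xs)"
          using xs b nonneg c that by (intro dynkin_best[where c = c and r = r]) (auto simp: r_def n_def)
        then show "pr {b} * ?g xs \<le> pr (dynkin v s C t xs)"
          using dynkin_nonneg[of t xs] by (simp add: in_prefix_def)
      qed
      moreover have "(\<Sum>xs\<in>permutations_of_set U. ?g xs) \<ge> fact n / 12"
      proof -
        have "r \<le> n" using r_upper by simp
        then have "(\<Sum>xs\<in>permutations_of_set U. in_prefix r xs c) = r * fact n / n"
          "(\<Sum>xs\<in>permutations_of_set U. in_prefix r xs c * in_prefix r xs b)
            = r * (real r - 1) * fact n / (n * (real n - 1))"
          using sum_permutations_in_prefix[OF finite_U _ c(1), of r]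
            sum_permutations_in_prefix_pair[OF finite_U _ c(1) b(1) c(2), of r] n n2
          by (simp_all add: n_def eq_divide_eq)
        then have "(\<Sum>xs\<in>permutations_of_set U. ?g xs)
            = r * fact n / n - r * (real r - 1) * fact n / (n * (real n - 1))"
          by (simp only: sum_subtractf)
        also have "\<dots> = fact n * (r * (real n - r) / (n * (real n - 1)))"
          using n n2 by (simp add: field_simps)
        also have "\<dots> \<ge> fact n * (1 / 12)"
        proof (rule mult_left_mono)
          \<comment> \<open>As \<open>r\<close> is at least 1, \<open>n < 3 * (r + 1)\<close> gives
            \<open>n \<le> 6 * r\<close>, while \<open>r \<le> n / 2\<close> gives
            \<open>n \<le> 2 * (n - r)\<close>.\<close>
          have "real n * (real n - 1) \<le> real n * real n" by (simp add: mult_left_mono)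
          also have "\<dots> \<le> (6 * real r) * (2 * (real n - r))"
            using r_lower r1 r_upper by (intro mult_mono) auto
          also have "\<dots> = 12 * (r * (real n - r))" by simp
          finally show "1 / 12 \<le> r * (real n - r) / (n * (real n - 1))"
            using n n2 by (simp add: le_divide_eq)
        qed simp
        finally show ?thesis by simp
      qed
      then have "pr {b} * (fact n / 12) \<le> (\<Sum>xs\<in>permutations_of_set U. pr {b} * ?g xs)"
        unfolding sum_distrib_left[symmetric] using nonneg by (rule mult_left_mono)
      ultimately have "pr {b} * (fact n / 12) \<le> (\<Sum>xs\<in>permutations_of_set U. pr (dynkin v s C t xs))"
        by linarith
      then show ?thesis by (simp add: field_simps)
    qed
  qed
  then show thesis using that b(1) b_max by (simp add: n_def)
qed

section \<open>The competitive ratio\<close>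

text \<open>All supports are finite, so the expectation is a finite sum. The fair coin gives the two
  halves, and exchanging the sums over orders and prefix lengths gives
  \<open>sample_mean\<close>.\<close>

lemma expectation_online_output:
  "measure_pmf.expectation (online_output v s C t k\<^sub>1 \<beta> U) pr
    = (\<Sum>xs\<in>permutations_of_set U. pr (dynkin v s C t xs)) / fact (card U) / 2
      + sample_mean U (\<lambda>k xs. pr (threshold_rule v s C k\<^sub>1 \<beta> U xs k)) / 2"
proof -
  define n where "n = card U"
  define T where "T = (\<lambda>k xs. pr (threshold_rule v s C k\<^sub>1 \<beta> U xs k))"
  have binom: "measure_pmf.expectation (map_pmf (threshold_rule v s C k\<^sub>1 \<beta> U xs) (binomial_pmf n (1/2))) pr
      = (\<Sum>k\<le>n. real (n choose k) / 2 ^ n * T k xs)" for xs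
  proof -
    have "measure_pmf.expectation (map_pmf (threshold_rule v s C k\<^sub>1 \<beta> U xs) (binomial_pmf n (1/2))) pr
        = (\<Sum>k\<le>n. pmf (binomial_pmf n (1/2)) k *\<^sub>R T k xs)"
      unfolding integral_map_pmf T_def
      by (rule integral_measure_pmf) (auto simp: set_pmf_binomial_eq)
    also have "\<dots> = (\<Sum>k\<le>n. real (n choose k) / 2 ^ n * T k xs)"
    proof (intro sum.cong refl)
      fix k assume "k \<in> {..n}"
      then have "(1/2::real) ^ k * (1 - 1/2) ^ (n - k) = 1 / 2 ^ n"
        by (simp add: power_one_over flip: power_add)
      then show "pmf (binomial_pmf n (1/2)) k *\<^sub>R T k xs = real (n choose k) / 2 ^ n * T k xs"
        by (simp add: mult.assoc)
    qed
    finally show ?thesis .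
  qed
  have fin: "finite (set_pmf (binomial_pmf n (1/2)))"
    by (simp add: set_pmf_binomial_eq)
  have alg: "measure_pmf.expectation (online_alg v s C t k\<^sub>1 \<beta> U xs) pr
      = pr (dynkin v s C t xs) / 2 + (\<Sum>k\<le>n. real (n choose k) / 2 ^ n * T k xs) / 2" for xs
    unfolding online_alg_def n_def[symmetric]
    using fin binom[of xs]
    by (subst pmf_expectation_bind[where A = UNIV]) (auto simp: UNIV_bool)
  have fin_alg: "finite (set_pmf (online_alg v s C t k\<^sub>1 \<beta> U xs))" for xs
    unfolding online_alg_def n_def[symmetric] using fin by (auto simp: set_bind_pmf)
  have "measure_pmf.expectation (online_output v s C t k\<^sub>1 \<beta> U) pr
      = (\<Sum>xs\<in>permutations_of_set U. measure_pmf.expectation (online_alg v s C t k\<^sub>1 \<beta> U xs) pr / fact n)"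
    unfolding online_output_def n_def using fin_alg finite_U
    by (subst pmf_expectation_bind_pmf_of_set) (auto simp: divide_inverse mult.commute)
  also have "\<dots> = (\<Sum>xs\<in>permutations_of_set U. pr (dynkin v s C t xs)) / fact n / 2
      + (\<Sum>xs\<in>permutations_of_set U. \<Sum>k\<le>n. real (n choose k) / 2 ^ n * T k xs / fact n) / 2"
    unfolding alg by (simp add: add_divide_distrib sum.distrib sum_divide_distrib mult_ac)
  also have "(\<Sum>xs\<in>permutations_of_set U. \<Sum>k\<le>n. real (n choose k) / 2 ^ n * T k xs / fact n)
      = sample_mean U T"
    unfolding sample_mean_def n_def[symmetric]
    by (subst sum.swap) (simp add: sum_distrib_left sum_divide_distrib)
  finally show ?thesis by (simp add: n_def T_def)
qed

lemma competitive_ratio: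
  assumes "inj_on t U" and opt: "is_arg_max pr (\<lambda>A. A \<subseteq> U) Ostar"
  shows "1 / 616 * pr Ostar \<le> measure_pmf.expectation (online_output v s C t 112 0.262 U) pr"
proof -
  define T where "T = sample_mean U (\<lambda>k xs. pr (threshold_rule v s C 112 0.262 U xs k))"
  define D where "D = (\<Sum>xs\<in>permutations_of_set U. pr (dynkin v s C t xs)) / fact (card U)"
  have T0: "0 \<le> T" unfolding T_def sample_mean_def
    by (intro sum_nonneg mult_nonneg_nonneg divide_nonneg_nonneg threshold_rule_nonneg) auto
  have D0: "0 \<le> D" unfolding D_def
    by (intro divide_nonneg_nonneg sum_nonneg dynkin_nonneg) simp
  have "1 / 616 * pr Ostar \<le> D / 2 + T / 2"
  proof (cases "U = {}")
    case True
    then have "pr Ostar = 0" using opt by (simp add: is_arg_max_def profit_empty)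
    then show ?thesis using T0 D0 by simp
  next
    case False
    obtain b where b: "b \<in> U" "\<And>e. e \<in> U \<Longrightarrow> pr {e} \<le> pr {b}" "pr {b} / 12 \<le> D"
      using dynkin_sum_ge[OF False assms(1)] unfolding D_def by blast
    \<comment> \<open>The maximum with 0 covers the case that every single element has negative
      profit.\<close>
    define M where "M = max 0 (pr {b})"
    have M: "0 \<le> M" "\<And>e. e \<in> U \<Longrightarrow> pr {e} \<le> M" and DM: "M / 12 \<le> D"
      using b D0 by (auto simp: M_def le_max_iff_disj)
    have le: "pr Ostar \<le> frac_opt U + M" by (rule opt_le_frac_opt_plus[OF opt M])
    show ?thesis
    proof (cases "frac_opt U \<le> 20 * M")
      \<comment> \<open>The optimum is at most \<open>21 * M\<close>, while the secretary half earns
        at least \<open>M / 24\<close>.\<close>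
      case True
      then show ?thesis using le DM T0 M(1) by simp
    next
      \<comment> \<open>The optimum is at most 21/20 of \<open>frac_opt U\<close>, while the
        threshold half earns at least 1/200 of it.\<close>
      case False
      then have "frac_opt U / 100 \<le> T"
        unfolding T_def using M by (intro threshold_rule_mean[of M]) auto
      then show ?thesis using le False D0 M(1) by simp
    qed
  qed
  then show ?thesis unfolding expectation_online_output T_def D_def by simp
qed

end

theorem theorem1:
  fixes U :: "'a set" and v :: "'a \<Rightarrow> int" and s :: "'a \<Rightarrow> nat" and C :: "real \<Rightarrow> real"
    and t :: "'a \<Rightarrow> nat" and Ostar :: "'a set"
  assumes "finite U"
    and "\<And>e. e \<in> U \<Longrightarrow> s e > 0"
    and "inj_on (elem_density v s) U"
    and "mono_on {0..} C" and "convex_on {0..} C" and "C 0 = 0"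
    and "inj_on t U"
    and "is_arg_max (profit v s C) (\<lambda>A. A \<subseteq> U) Ostar"
  shows "measure_pmf.expectation (online_output v s C t 112 0.262 U) (profit v s C)
           \<ge> 1 / 616 * profit v s C Ostar"
proof -
  interpret convex_cost U v s C
    using assms(1-6) by unfold_locales
  show ?thesis using competitive_ratio[OF assms(7,8)] .
qed

end
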